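(* Let $(V,F)$ be an $n$-dimensional Minkowski space with the Busemann–Hausdorff (resp. Holmes–Thompson) volume form $d\mu$. Then every hyperplane, every Minkowski hypersphere and reverse Minkowski hypersphere $\hat S^{n-1}_{F_\pm}(r)$, and every (reverse) $F^*$-Minkowski cylinder $\hat S^{m-1}_{\tilde F_\pm}(r)\times\mathbb R^{n-m}$ is an isoparametric hypersurface of $(V,F,d\mu)$ with one or two distinct constant principal curvatures.
   Context: Minkowski space. $V$ is an $n$-dimensional real vector space and $F:V\to[0,\infty)$ is smooth on $V\setminus\{0\}$, $F(\lambda y)=\lambda F(y)$ for $\lambda>0$, with $g_{ij}(y)=\frac12[F^2]_{y^iy^j}$ positive definite for $y\neq 0$ ($F$ need not be reversible); $g_y(U,W)=g_{ij}(y)U^iW^j$. It is viewed as a Finsler manifold with $F(x,y)=F(y)$, $y\in T_xV=V$; the Chern connection coefficients vanish in linear coordinates. The Busemann–Hausdorff volume form has density $\sigma=\mathrm{vol}(\mathbb B^n)/\mathrm{vol}\{y:F(y)<1\}$ and the Holmes–Thompson one $\sigma=\frac1{\mathrm{vol}(\mathbb B^n)}\int_{\{F(y)<1\}}\det(g_{ij}(y))\,dy$ (both constant in linear coordinates). The dual metric is $F^*(\xi)=\sup_{y\neq0}\xi(y)/F(y)$ on $V^*$. Gradient and Laplacian. Legendre transformation: $\mathcal L(y)=F(y)[F]_{y^i}(y)dx^i$, $\mathcal L(0)=0$; $\nabla f=\mathcal L^{-1}(df)$; for $d\mu=\sigma dx$, $\Delta f=\operatorname{div}\nabla f=\frac1\sigma\partial_{x^i}(\sigma(\nabla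 f)^i)$. Isoparametric. Let $f$ be a non-constant continuous function on $V$, smooth on $V\setminus S$ with $S$ closed of measure zero; $M_f=\{x\in V\setminus S:df(x)\ne0\}$, $J=f(M_f)$. $f$ is isoparametric if there are a smooth $\tilde a$ and a continuous $\tilde b$ on $J$ with $F(\nabla f)=\tilde a(f)$ and $\Delta f=\tilde b(f)$ on $M_f$. The regular level surfaces $N_t=f^{-1}(t)$ are called isoparametric hypersurfaces. Their principal curvatures are the eigenvalues of $X\mapsto-D_X\mathbf n$ on $TN_t$, where $\mathbf n=\nabla f/F(\nabla f)$ and $D$ is the ordinary derivative in $V$. Special hypersurfaces. $\hat S^{n-1}_{F_+}(r)$ is the Minkowski hypersphere $\{F(x-x_0)=r\}$ and $\hat S^{n-1}_{F_-}(r)$ the reverse Minkowski hypersphere $\{F(x_0-x)=r\}$, $r>0$. $F^*$-Minkowski cylinders: fix a Euclidean inner product identifying $V$ with $V^*$; let $2\le m\le n-1$, let $\bar V\subset V$ be an $m$-dimensional subspace and $\bar V^*\subset V^*$ the corresponding $m$-dimensional subspace, so in suitable orthonormal coordinates $\bar V=\{(x^1,\dots,x^m,0,\dots,0)\}$, $\bar V^*=\{(\xi_1,\dots,\xi_m,0,\dots,0)\}$. Let $\tilde F(\bar y)=\sup_{\bar\xi\in\bar V^*\setminus0}\bar\xi(\bar y)/F^*(\bar\xi)$, $\bar y\in\bar V$, the dual metric of $F^*|_{\bar V^*}$ (in general $\tilde F\ne F|_{\bar V}$). For $x=(x^1,\dots,x^n)$ write $\bar x=(x^1,\dots,x^m,0,\dots,0)$.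 Then $\hat S^{m-1}_{\tilde F_\pm}(r)\times\mathbb R^{n-m}=\{x\in V:\tilde F(\pm(\bar x-\bar x_0))=r\}$, $\bar x_0\in\bar V$; sign $+$ is the $F^*$-Minkowski cylinder, sign $-$ the reverse one. *)

theory Defs
  imports "HOL-Analysis.Analysis"
begin

section \<open>Smooth maps\<close>

text \<open>Meant for open \<^term>\<open>U\<close>. In finite dimensions a map is \<open>C\<^sup>k\<^sup>+\<^sup>1\<close> iff it is differentiable
  with \<open>C\<^sup>k\<close> directional derivatives, which avoids derivatives of operator-valued maps.\<close>

primrec Ck_on :: "nat \<Rightarrow> 'a set \<Rightarrow> ('a::euclidean_space \<Rightarrow> 'b::real_normed_vector) \<Rightarrow> bool" where
  "Ck_on 0 U f \<longleftrightarrow> continuous_on U f"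
| "Ck_on (Suc k) U f \<longleftrightarrow> (\<forall>x\<in>U. f differentiable (at x)) \<and>
     (\<forall>v. Ck_on k U (\<lambda>x. frechet_derivative f (at x) v))"

definition smooth_on :: "'a set \<Rightarrow> ('a::euclidean_space \<Rightarrow> 'b::real_normed_vector) \<Rightarrow> bool" where
  "smooth_on U f \<longleftrightarrow> (\<forall>k. Ck_on k U f)"


section \<open>Minkowski spaces\<close>

text \<open>\<open>V\<close> is \<^typ>\<open>real^'n\<close>, i.e. a vector space with chosen linear coordinates; \<open>V\<^sup>*\<close> is
  \<^typ>\<open>(real^'n) \<Rightarrow>\<^sub>L real\<close>.\<close>

definition partial_deriv :: "'n \<Rightarrow> (real^'n \<Rightarrow> real) \<Rightarrow> real^'n \<Rightarrow> real" where
  "partial_deriv i f x = frechet_derivative f (at x) (axis i 1)"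

definition fundamental_tensor :: "(real^'n \<Rightarrow> real) \<Rightarrow> real^'n \<Rightarrow> real^'n^'n" where
  "fundamental_tensor F y =
     (\<chi> i j. partial_deriv j (partial_deriv i (\<lambda>z. (F z)\<^sup>2)) y / 2)"

definition minkowski_metric :: "(real^'n \<Rightarrow> real) \<Rightarrow> bool" where
  "minkowski_metric F \<longleftrightarrow>
     (\<forall>y. 0 \<le> F y) \<and>
     smooth_on (UNIV - {0}) F \<and>
     (\<forall>c y. 0 < c \<longrightarrow> F (c *\<^sub>R y) = c * F y) \<and>
     (\<forall>y U. y \<noteq> 0 \<and> U \<noteq> 0 \<longrightarrow> 0 < U \<bullet> (fundamental_tensor F y *v U))"

definition busemann_hausdorff_density :: "(real^'n \<Rightarrow> real) \<Rightarrow> real" where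
  "busemann_hausdorff_density F =
     measure lborel (ball (0::real^'n) 1) / measure lborel {y. F y < 1}"

text \<open>The integrand is meaningful only for \<open>y \<noteq> 0\<close>; a single point does not affect the integral.\<close>

definition holmes_thompson_density :: "(real^'n \<Rightarrow> real) \<Rightarrow> real" where
  "holmes_thompson_density F =
     (LINT y:{y. F y < 1}|lborel. det (fundamental_tensor F y)) /
     measure lborel (ball (0::real^'n) 1)"

definition dual_metric :: "(real^'n \<Rightarrow> real) \<Rightarrow> ((real^'n) \<Rightarrow>\<^sub>L real) \<Rightarrow> real" where
  "dual_metric F \<xi> = (SUP y\<in>UNIV - {0}. blinfun_apply \<xi> y / F y)"


section \<open>Gradient and Laplacian\<close>

definition differential :: "(real^'n \<Rightarrow> real) \<Rightarrow> real^'n \<Rightarrow> (real^'n) \<Rightarrow>\<^sub>L real" where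
  "differential f x = Blinfun (frechet_derivative f (at x))"

definition legendre :: "(real^'n \<Rightarrow> real) \<Rightarrow> real^'n \<Rightarrow> (real^'n) \<Rightarrow>\<^sub>L real" where
  "legendre F y = (if y = 0 then 0 else F y *\<^sub>R differential F y)"

definition gradient :: "(real^'n \<Rightarrow> real) \<Rightarrow> (real^'n \<Rightarrow> real) \<Rightarrow> real^'n \<Rightarrow> real^'n" where
  "gradient F f x = inv (legendre F) (differential f x)"

text \<open>\<open>\<sigma>\<close> is a number because both volume densities are constant in linear coordinates.\<close>

definition divergence :: "real \<Rightarrow> (real^'n \<Rightarrow> real^'n) \<Rightarrow> real^'n \<Rightarrow> real" where
  "divergence \<sigma> X x = 1 / \<sigma> * (\<Sum>i\<in>UNIV. partial_deriv i (\<lambda>z. \<sigma> * X z $ i) x)"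

definition laplacian :: "(real^'n \<Rightarrow> real) \<Rightarrow> real \<Rightarrow> (real^'n \<Rightarrow> real) \<Rightarrow> real^'n \<Rightarrow> real" where
  "laplacian F \<sigma> f = divergence \<sigma> (gradient F f)"


section \<open>Isoparametric functions and hypersurfaces\<close>

definition regular_points :: "(real^'n) set \<Rightarrow> (real^'n \<Rightarrow> real) \<Rightarrow> (real^'n) set" where
  "regular_points S f = {x. x \<notin> S \<and> differential f x \<noteq> 0}"

text \<open>The set \<^term>\<open>f ` regular_points S f\<close> is open, since \<^term>\<open>f\<close> is a submersion on the open
  set \<^term>\<open>regular_points S f\<close>; so smoothness on it is unambiguous.\<close>

definition isoparametric_function ::
    "(real^'n \<Rightarrow> real) \<Rightarrow> real \<Rightarrow> (real^'n) set \<Rightarrow> (real^'n \<Rightarrow> real) \<Rightarrow> bool" where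
  "isoparametric_function F \<sigma> S f \<longleftrightarrow>
     \<not> f constant_on UNIV \<and> continuous_on UNIV f \<and>
     closed S \<and> negligible S \<and> smooth_on (UNIV - S) f \<and>
     (\<exists>(a::real \<Rightarrow> real) (b::real \<Rightarrow> real).
        smooth_on (f ` regular_points S f) a \<and>
        continuous_on (f ` regular_points S f) b \<and>
        (\<forall>x\<in>regular_points S f.
           F (gradient F f x) = a (f x) \<and> laplacian F \<sigma> f x = b (f x)))"

definition regular_level_surface ::
    "(real^'n) set \<Rightarrow> (real^'n \<Rightarrow> real) \<Rightarrow> (real^'n) set \<Rightarrow> bool" where
  "regular_level_surface S f N \<longleftrightarrow>
     (\<exists>t. N = f -` {t}) \<and> N \<noteq> {} \<and> N \<subseteq> regular_points S f"

definition unit_normal :: "(real^'n \<Rightarrow> real) \<Rightarrow> (real^'n \<Rightarrow> real) \<Rightarrow> real^'n \<Rightarrow> real^'n" where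
  "unit_normal F f x = gradient F f x /\<^sub>R F (gradient F f x)"

text \<open>The tangent space of a regular level surface of \<open>f\<close> at \<open>x\<close> is the kernel of \<open>df\<^sub>x\<close>.\<close>

definition principal_curvatures ::
    "(real^'n \<Rightarrow> real) \<Rightarrow> (real^'n \<Rightarrow> real) \<Rightarrow> real^'n \<Rightarrow> real set" where
  "principal_curvatures F f x =
     {\<kappa>. \<exists>X. X \<noteq> 0 \<and> blinfun_apply (differential f x) X = 0 \<and>
          - frechet_derivative (unit_normal F f) (at x) X = \<kappa> *\<^sub>R X}"

text \<open>For non-reversible \<open>F\<close> the normal, hence the curvatures, depend on the side of \<open>N\<close> to which
  \<open>\<nabla>f\<close> points, so the curvatures are those of the function exhibiting \<open>N\<close> as isoparametric.\<close>

definition isoparametric_hypersurface_with ::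
    "(real^'n \<Rightarrow> real) \<Rightarrow> real \<Rightarrow> nat \<Rightarrow> (real^'n) set \<Rightarrow> bool" where
  "isoparametric_hypersurface_with F \<sigma> k N \<longleftrightarrow>
     (\<exists>S f. isoparametric_function F \<sigma> S f \<and> regular_level_surface S f N \<and>
        (\<exists>K. finite K \<and> card K = k \<and> (\<forall>x\<in>N. principal_curvatures F f x = K)))"


section \<open>Hyperplanes, hyperspheres and cylinders\<close>

definition hyperplane :: "(real^'n) set \<Rightarrow> bool" where
  "hyperplane N \<longleftrightarrow> (\<exists>a c. a \<noteq> 0 \<and> N = {x. a \<bullet> x = c})"

definition minkowski_sphere :: "(real^'n \<Rightarrow> real) \<Rightarrow> real^'n \<Rightarrow> real \<Rightarrow> (real^'n) set" where
  "minkowski_sphere F x0 r = {x. F (x - x0) = r}"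

definition reverse_minkowski_sphere :: "(real^'n \<Rightarrow> real) \<Rightarrow> real^'n \<Rightarrow> real \<Rightarrow> (real^'n) set" where
  "reverse_minkowski_sphere F x0 r = {x. F (x0 - x) = r}"

text \<open>The inner product identifying \<open>V\<close> with \<open>V\<^sup>*\<close> is an arbitrary one, \<open>ip\<close>, not necessarily the
  standard one of the coordinates; \<open>W\<close> is the subspace \<open>\<bar>V\<close>.\<close>

definition euclidean_inner_product :: "(real^'n \<Rightarrow> real^'n \<Rightarrow> real) \<Rightarrow> bool" where
  "euclidean_inner_product ip \<longleftrightarrow>
     bilinear ip \<and> (\<forall>x y. ip x y = ip y x) \<and> (\<forall>x. x \<noteq> 0 \<longrightarrow> 0 < ip x x)"

definition dual_subspace ::
    "(real^'n \<Rightarrow> real^'n \<Rightarrow> real) \<Rightarrow> (real^'n) set \<Rightarrow> ((real^'n) \<Rightarrow>\<^sub>L real) set" where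
  "dual_subspace ip W = {\<xi>. \<exists>w\<in>W. \<forall>y. blinfun_apply \<xi> y = ip w y}"

text \<open>The metric \<open>F\<close>-tilde on \<open>W\<close>, dual to the restriction of \<open>F\<^sup>*\<close> to \<^term>\<open>dual_subspace ip W\<close>.\<close>

definition cylinder_metric ::
    "(real^'n \<Rightarrow> real) \<Rightarrow> (real^'n \<Rightarrow> real^'n \<Rightarrow> real) \<Rightarrow> (real^'n) set \<Rightarrow> real^'n \<Rightarrow> real" where
  "cylinder_metric F ip W y =
     (SUP \<xi>\<in>dual_subspace ip W - {0}. blinfun_apply \<xi> y / dual_metric F \<xi>)"

text \<open>The map \<open>x \<mapsto> (x\<^sup>1, \<dots>, x\<^sup>m, 0, \<dots>, 0)\<close> in \<open>ip\<close>-orthonormal coordinates adapted to \<open>W\<close>.\<close>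

definition orth_projection ::
    "(real^'n \<Rightarrow> real^'n \<Rightarrow> real) \<Rightarrow> (real^'n) set \<Rightarrow> real^'n \<Rightarrow> real^'n" where
  "orth_projection ip W x = (THE u. u \<in> W \<and> (\<forall>w\<in>W. ip w (x - u) = 0))"

definition dual_minkowski_cylinder ::
    "(real^'n \<Rightarrow> real) \<Rightarrow> (real^'n \<Rightarrow> real^'n \<Rightarrow> real) \<Rightarrow> (real^'n) set \<Rightarrow> real^'n \<Rightarrow> real
      \<Rightarrow> (real^'n) set" where
  "dual_minkowski_cylinder F ip W x0 r =
     {x. cylinder_metric F ip W (orth_projection ip W x - x0) = r}"

definition reverse_dual_minkowski_cylinder ::
    "(real^'n \<Rightarrow> real) \<Rightarrow> (real^'n \<Rightarrow> real^'n \<Rightarrow> real) \<Rightarrow> (real^'n) set \<Rightarrow> real^'n \<Rightarrow> real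
      \<Rightarrow> (real^'n) set" where
  "reverse_dual_minkowski_cylinder F ip W x0 r =
     {x. cylinder_metric F ip W (- (orth_projection ip W x - x0)) = r}"

end

theory Submission
  imports Defs
begin

text \<open>Each of the hypersurfaces other than the hyperplane (a level set of a linear function, whose
  gradient is constant) is a level set of \<open>f x = \<epsilon> * Q (\<epsilon> *\<^sub>R (x - x0))\<close>, \<open>\<epsilon> = \<plusminus> 1\<close>. Here
  \<open>Q x = F (tau x)\<close>, where \<open>tau x\<close> is the \<open>F\<close>-shortest vector of the coset \<open>x + ker P\<close> for a linear
  projection \<open>P\<close>: the identity for hyperspheres, the orthogonal projection onto \<open>W\<close> for cylinders,
  because the metric dual to \<open>F\<^sup>*\<close> restricted to \<open>W\<^sup>*\<close> is the quotient metric of \<open>F\<close>.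

  The differential of \<open>Q\<close> at \<open>x\<close> is that of \<open>F\<close> at \<open>tau x\<close>, so the gradient of \<open>f\<close> is \<open>tau / Q\<close> at
  \<open>\<epsilon> *\<^sub>R (x - x0)\<close>, of \<open>F\<close>-length 1. From \<open>P \<circ> tau = P\<close> and \<open>tau \<circ> P = tau\<close> one
  reads off that \<open>dtau\<close> has the trace of \<open>P\<close>, whence the Laplacian of \<open>f\<close> is \<open>(tr P - 1) / f\<close>, and that on tangent
  vectors \<open>dtau\<close> has eigenvalue 1 and, when \<open>ker P\<close> is nontrivial, also 0; so the principal
  curvatures on the level \<open>Q = r\<close> are \<open>- \<epsilon> / r\<close> and possibly 0.\<close>

section \<open>Calculus of smooth functions\<close>

lemma Ck_on_cong:
  assumes "open U" "\<And>x. x \<in> U \<Longrightarrow> f x = g x"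
  shows "Ck_on k U f \<longleftrightarrow> Ck_on k U g"
proof -
  have "Ck_on k U f \<Longrightarrow> (\<And>x. x \<in> U \<Longrightarrow> f x = g x) \<Longrightarrow> Ck_on k U g" for f g :: "'a \<Rightarrow> 'b"
  proof (induction k arbitrary: f g)
    case 0
    then show ?case by (metis Ck_on.simps(1) continuous_on_cong)
  next
    case (Suc k)
    have d: "(g has_derivative frechet_derivative f (at x)) (at x)" if "x \<in> U" for x
      using has_derivative_transform_within_open[OF _ assms(1) that Suc.prems(2)] Suc.prems(1) that
      by (simp add: frechet_derivative_works)
    have "Ck_on k U (\<lambda>x. frechet_derivative g (at x) v)" for v
      using Suc.IH[of "\<lambda>x. frechet_derivative f (at x) v" "\<lambda>x. frechet_derivative g (at x) v"]
        Suc.prems(1) frechet_derivative_at[OF d] by auto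
    then show ?case using d by (auto simp: differentiable_def)
  qed
  then show ?thesis using assms(2) by metis
qed

text \<open>Lets an explicit derivative \<open>f'\<close> stand in for the choice operator
  \<open>frechet_derivative\<close>, so that closure properties follow from the differentiation
  rules by induction on \<open>k\<close>.\<close>

lemma Ck_on_SucI:
  assumes "open U" "\<And>x. x \<in> U \<Longrightarrow> (f has_derivative f' x) (at x)"
    "\<And>v. Ck_on k U (\<lambda>x. f' x v)"
  shows "Ck_on (Suc k) U f"
proof -
  have "Ck_on k U (\<lambda>x. frechet_derivative f (at x) v)" for v
    using Ck_on_cong[OF assms(1), of "\<lambda>x. frechet_derivative f (at x) v" "\<lambda>x. f' x v" k]
      assms(3) frechet_derivative_at[OF assms(2)] by auto
  then show ?thesis using assms(2) by (auto simp: differentiable_def)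
qed

lemma Ck_on_SucD:
  assumes "Ck_on (Suc k) U f"
  shows "\<And>x. x \<in> U \<Longrightarrow> (f has_derivative frechet_derivative f (at x)) (at x)"
    "\<And>v. Ck_on k U (\<lambda>x. frechet_derivative f (at x) v)"
  using assms by (auto simp: frechet_derivative_works)

lemma Ck_on_Suc_imp: "Ck_on (Suc k) U f \<Longrightarrow> Ck_on k U f"
proof (induction k arbitrary: f)
  case 0
  then show ?case
    by (auto intro!: continuous_at_imp_continuous_on differentiable_imp_continuous_within)
next
  case (Suc k)
  then show ?case by (metis Ck_on.simps(2))
qed

lemma Ck_on_const: "Ck_on k U (\<lambda>x. c)"
  by (induction k arbitrary: c) auto

lemma Ck_on_add:
  "\<lbrakk>open U; Ck_on k U f; Ck_on k U g\<rbrakk> \<Longrightarrow> Ck_on k U (\<lambda>x. f x + g x)"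
proof (induction k arbitrary: f g)
  case 0
  then show ?case by (auto intro: continuous_on_add)
next
  case (Suc k)
  then show ?case
    by (intro Ck_on_SucI[OF _ has_derivative_add[OF Ck_on_SucD(1) Ck_on_SucD(1)]] Suc.IH Ck_on_SucD(2))
qed

lemma Ck_on_mult:
  fixes f g :: "'a::euclidean_space \<Rightarrow> 'b::real_normed_algebra"
  shows "\<lbrakk>open U; Ck_on k U f; Ck_on k U g\<rbrakk> \<Longrightarrow> Ck_on k U (\<lambda>x. f x * g x)"
proof (induction k arbitrary: f g)
  case 0
  then show ?case by (auto intro: continuous_on_mult)
next
  case (Suc k)
  note f = Suc.prems(2) and g = Suc.prems(3)
  show ?case
    by (rule Ck_on_SucI[OF _ has_derivative_mult[OF Ck_on_SucD(1)[OF f] Ck_on_SucD(1)[OF g]]])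
      (simp_all only: Ck_on_add Suc.IH Ck_on_SucD(2)[OF f] Ck_on_SucD(2)[OF g]
        Ck_on_Suc_imp[OF f] Ck_on_Suc_imp[OF g] Suc.prems(1))
qed

lemma Ck_on_inverse:
  fixes f :: "'a::euclidean_space \<Rightarrow> 'b::real_normed_div_algebra"
  assumes "open U" "\<And>x. x \<in> U \<Longrightarrow> f x \<noteq> 0" "Ck_on k U f"
  shows "Ck_on k U (\<lambda>x. inverse (f x))"
  using assms(3)
proof (induction k)
  case 0
  then show ?case using assms(2) by (auto intro: continuous_on_inverse)
next
  case (Suc k)
  have i: "Ck_on k U (\<lambda>x. inverse (f x))" using Suc Ck_on_Suc_imp by blast
  have "Ck_on k U (\<lambda>x. (-1) * (inverse (f x) * frechet_derivative f (at x) v * inverse (f x)))" for v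
    by (intro Ck_on_mult Ck_on_const i Ck_on_SucD(2) Suc.prems assms(1))
  then show ?case
    by (intro Ck_on_SucI[OF assms(1) Deriv.has_derivative_inverse[OF assms(2) Ck_on_SucD(1)[OF Suc.prems]]])
      simp_all
qed

lemma Ck_on_sum:
  assumes "open U" "\<And>i. i \<in> I \<Longrightarrow> Ck_on k U (f i)"
  shows "Ck_on k U (\<lambda>x. \<Sum>i\<in>I. f i x)"
  using assms(2)
  by (induction I rule: infinite_finite_induct) (auto intro: Ck_on_const Ck_on_add assms(1))

lemma Ck_on_prod:
  fixes f :: "'i \<Rightarrow> 'a::euclidean_space \<Rightarrow> 'b::real_normed_field"
  assumes "open U" "\<And>i. i \<in> I \<Longrightarrow> Ck_on k U (f i)"
  shows "Ck_on k U (\<lambda>x. \<Prod>i\<in>I. f i x)"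
  using assms(2)
  by (induction I rule: infinite_finite_induct) (auto intro: Ck_on_const Ck_on_mult assms(1))

lemma Ck_on_det:
  fixes A :: "'a::euclidean_space \<Rightarrow> real^'n^'n"
  assumes "open U" "\<And>i j. Ck_on k U (\<lambda>x. A x $ i $ j)"
  shows "Ck_on k U (\<lambda>x. det (A x))"
  unfolding det_def
  by (intro Ck_on_sum Ck_on_mult Ck_on_prod Ck_on_const assms)

lemma Ck_on_affine:
  assumes "bounded_linear L" "open V" "Ck_on k U f" "\<And>x. x \<in> V \<Longrightarrow> L x + c \<in> U"
  shows "Ck_on k V (\<lambda>x. f (L x + c))"
  using assms(3)
proof (induction k arbitrary: f)
  case 0
  have "continuous_on V (\<lambda>x. L x + c)"
    by (intro continuous_on_add continuous_on_const linear_continuous_on assms(1))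
  with 0 assms(4) show ?case
    by (auto intro: continuous_on_compose2[of U f V "\<lambda>x. L x + c"])
next
  case (Suc k)
  have "((\<lambda>x. L x + c) has_derivative L) (at x)" for x
    using has_derivative_add[OF bounded_linear_imp_has_derivative[OF assms(1)] has_derivative_const] by simp
  from has_derivative_compose[OF this Ck_on_SucD(1)[OF Suc.prems]]
  have "((\<lambda>x. f (L x + c)) has_derivative (\<lambda>v. frechet_derivative f (at (L x + c)) (L v))) (at x)"
    if "x \<in> V" for x
    using assms(4) that by blast
  then show ?case
    by (rule Ck_on_SucI[OF assms(2)]) (assumption | rule Suc.IH Ck_on_SucD(2)[OF Suc.prems])+
qed

text \<open>Also serves for a bounded linear functional, taken as its own derivative, to represent
  it by its vector of coordinates.\<close>

lemma has_derivative_expand: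
  assumes "(f has_derivative f') (at (x::real^'n))"
  shows "f' v = (\<Sum>i\<in>UNIV. v $ i *\<^sub>R f' (axis i 1))"
proof -
  have "linear f'" using assms has_derivative_linear by blast
  then have "f' (\<Sum>i\<in>UNIV. v $ i *\<^sub>R axis i 1) = (\<Sum>i\<in>UNIV. v $ i *\<^sub>R f' (axis i 1))"
    by (simp add: linear_sum linear_scale)
  then show ?thesis
    using basis_expansion[of v] by (simp add: scalar_mult_eq_scaleR)
qed

text \<open>Cramer's rule: each coordinate of the solution is a quotient of determinants with
  nonvanishing denominator.\<close>

lemma Ck_on_solve:
  fixes A :: "'a::euclidean_space \<Rightarrow> real^'n^'n"
  assumes U: "open U" and A: "\<And>i j. Ck_on k U (\<lambda>x. A x $ i $ j)"
    and inv: "\<And>x. x \<in> U \<Longrightarrow> invertible (A x)" and y: "\<And>x. x \<in> U \<Longrightarrow> A x *v y x = b"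
  shows "Ck_on k U (\<lambda>x. y x $ m)"
proof -
  let ?B = "\<lambda>x. \<chi> i j. if j = m then b $ i else A x $ i $ j"
  have "y x $ m = det (?B x) * inverse (det (A x))" if "x \<in> U" for x
    using y[OF that] inv[OF that] by (simp add: cramer invertible_det_nz divide_inverse)
  moreover have "Ck_on k U (\<lambda>x. ?B x $ i $ j)" for i j
    using A Ck_on_const by (cases "j = m") auto
  then have "Ck_on k U (\<lambda>x. det (?B x) * inverse (det (A x)))"
    using inv invertible_det_nz
    by (intro Ck_on_mult Ck_on_inverse Ck_on_det U A) auto
  ultimately show ?thesis using Ck_on_cong[OF U] by (metis (no_types, lifting))
qed

section \<open>Minkowski metrics and the Legendre transformation\<close>

lemma differential_apply:
  "f differentiable (at x) \<Longrightarrow> blinfun_apply (differential f x) = frechet_derivative f (at x)"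
  unfolding differential_def
  by (metis bounded_linear_Blinfun_apply frechet_derivative_works has_derivative_bounded_linear)

text \<open>The Legendre covector as a vector under the standard dot product; away from the origin
  it is half the Euclidean gradient of the square of \<open>F\<close>.\<close>

definition legendre_vector :: "(real^'n \<Rightarrow> real) \<Rightarrow> real^'n \<Rightarrow> real^'n" where
  "legendre_vector F y = (\<chi> i. blinfun_apply (legendre F y) (axis i 1))"

locale minkowski_space =
  fixes F :: "real^'n \<Rightarrow> real"
  assumes minkowski: "minkowski_metric F"
begin

abbreviation L :: "real^'n \<Rightarrow> real^'n" where "L \<equiv> legendre_vector F"
abbreviation G :: "real^'n \<Rightarrow> real^'n^'n" where "G \<equiv> fundamental_tensor F"

lemma F_nonneg: "0 \<le> F y"
  and F_smooth: "Ck_on k (UNIV - {0}) F"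
  and F_scale: "0 < c \<Longrightarrow> F (c *\<^sub>R y) = c * F y"
  and G_pos: "y \<noteq> 0 \<Longrightarrow> U \<noteq> 0 \<Longrightarrow> 0 < U \<bullet> (G y *v U)"
  using minkowski by (auto simp: minkowski_metric_def smooth_on_def)

lemma F_zero [simp]: "F 0 = 0"
  using F_scale[of 2 0] by simp

lemma open_nonzero: "open (UNIV - {0::real^'n})"
  by auto

lemma F_has_derivative: "y \<noteq> 0 \<Longrightarrow> (F has_derivative frechet_derivative F (at y)) (at y)"
  using Ck_on_SucD(1)[OF F_smooth] by auto

lemma F_continuous_nonzero: "continuous_on (UNIV - {0}) F"
  using F_smooth[of 0] by simp

lemma legendre_apply: "blinfun_apply (legendre F y) v = L y \<bullet> v"
proof -
  have "blinfun_apply (legendre F y) v = (\<Sum>i\<in>UNIV. v $ i *\<^sub>R legendre F y (axis i 1))"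
    by (rule has_derivative_expand[OF bounded_linear_imp_has_derivative[OF blinfun.bounded_linear_right]])
  then show ?thesis by (simp add: legendre_vector_def inner_vec_def mult.commute)
qed

lemma L_zero [simp]: "L 0 = 0"
  by (simp add: legendre_vector_def legendre_def vec_eq_iff)

lemma L_inner: "y \<noteq> 0 \<Longrightarrow> L y \<bullet> v = F y * frechet_derivative F (at y) v"
  using differential_apply[OF differentiableI[OF F_has_derivative]]
  by (simp add: legendre_apply[symmetric] legendre_def blinfun.scaleR_left)

lemma legendre_eq_iff: "legendre F y = \<xi> \<longleftrightarrow> (\<forall>v. blinfun_apply \<xi> v = L y \<bullet> v)"
  by (metis blinfun_eqI legendre_apply)

lemma F2_has_derivative: "y \<noteq> 0 \<Longrightarrow> ((\<lambda>z. (F z)\<^sup>2) has_derivative (\<lambda>v. 2 * (L y \<bullet> v))) (at y)"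
  using has_derivative_power[OF F_has_derivative, of y 2] by (simp add: L_inner mult_ac)

lemma L_nth: "y \<noteq> 0 \<Longrightarrow> L y $ i = partial_deriv i (\<lambda>z. (F z)\<^sup>2) y / 2"
  unfolding partial_deriv_def frechet_derivative_at[OF F2_has_derivative, symmetric]
  by (simp add: inner_axis)

lemma F2_partial_smooth: "Ck_on k (UNIV - {0}) (partial_deriv i (\<lambda>z. (F z)\<^sup>2))"
  using Ck_on_SucD(2)[OF Ck_on_mult[OF open_nonzero F_smooth F_smooth]]
  unfolding partial_deriv_def power2_eq_square by fast

lemma G_smooth: "Ck_on k (UNIV - {0}) (\<lambda>y. G y $ i $ j)"
proof -
  have "Ck_on k (UNIV - {0}) (\<lambda>y. partial_deriv j (partial_deriv i (\<lambda>z. (F z)\<^sup>2)) y * (1/2))"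
    using Ck_on_SucD(2)[OF F2_partial_smooth]
    unfolding partial_deriv_def[of j] by (intro Ck_on_mult Ck_on_const open_nonzero)
  then show ?thesis by (simp add: fundamental_tensor_def)
qed

lemma L_has_derivative:
  assumes "y \<noteq> 0"
  shows "(L has_derivative (\<lambda>v. G y *v v)) (at y)"
proof -
  have "((\<lambda>y. L y $ i) has_derivative (\<lambda>v. (G y *v v) $ i)) (at y)" for i
  proof -
    let ?p = "partial_deriv i (\<lambda>z. (F z)\<^sup>2)"
    have d: "(?p has_derivative frechet_derivative ?p (at y)) (at y)"
      using Ck_on_SucD(1)[OF F2_partial_smooth] assms by auto
    have "frechet_derivative ?p (at y) v / 2 = (G y *v v) $ i" for v
      using has_derivative_expand[OF d, of v]
      by (simp add: matrix_vector_mult_def fundamental_tensor_def partial_deriv_def sum_divide_distrib mult.commute)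
    then have "((\<lambda>y. ?p y / 2) has_derivative (\<lambda>v. (G y *v v) $ i)) (at y)"
      using has_derivative_mult_left[OF d, of "1/2"] by simp
    then show ?thesis
      by (rule has_derivative_transform_within_open[OF _ open_nonzero]) (use assms L_nth in auto)
  qed
  then show ?thesis
    by (subst has_derivative_componentwise_within) (auto simp: Basis_vec_def inner_axis)
qed

section \<open>Restriction to lines, homogeneity and convexity\<close>

lemma F2_line_has_derivative:
  assumes "y + t *\<^sub>R k \<noteq> 0"
  shows "((\<lambda>t. (F (y + t *\<^sub>R k))\<^sup>2) has_real_derivative 2 * (L (y + t *\<^sub>R k) \<bullet> k)) (at t)"
proof -
  have "((\<lambda>t. y + t *\<^sub>R k) has_derivative (\<lambda>h. h *\<^sub>R k)) (at t)"
    by (auto intro!: derivative_eq_intros)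
  from has_derivative_compose[OF this F2_has_derivative[OF assms]] show ?thesis
    by (rule has_derivative_imp_has_field_derivative) simp
qed

lemma L_line_has_derivative:
  assumes "y + t *\<^sub>R k \<noteq> 0"
  shows "((\<lambda>t. L (y + t *\<^sub>R k) \<bullet> v) has_real_derivative (G (y + t *\<^sub>R k) *v k) \<bullet> v) (at t)"
proof -
  have "((\<lambda>t. y + t *\<^sub>R k) has_derivative (\<lambda>h. h *\<^sub>R k)) (at t)"
    by (auto intro!: derivative_eq_intros)
  from has_derivative_inner_left[OF has_derivative_compose[OF this L_has_derivative[OF assms]], of v]
  show ?thesis
    by (rule has_derivative_imp_has_field_derivative) (simp add: matrix_vector_mult_scaleR)
qed

text \<open>The square of \<open>F\<close> at \<open>c\<close> times \<open>z\<close> is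
  differentiated twice over, by the chain rule and by homogeneity; uniqueness of derivatives
  compares the results.\<close>

lemma L_scale:
  assumes "0 < c"
  shows "L (c *\<^sub>R y) = c *\<^sub>R L y"
proof (cases "y = 0")
  case False
  with assms have n: "c *\<^sub>R y \<noteq> 0" by simp
  have "((\<lambda>z. c *\<^sub>R z) has_derivative (\<lambda>v. c *\<^sub>R v)) (at y)"
    by (auto intro!: derivative_eq_intros)
  from has_derivative_compose[OF this F2_has_derivative[OF n]]
  have "((\<lambda>z. c\<^sup>2 * (F z)\<^sup>2) has_derivative (\<lambda>v. 2 * (L (c *\<^sub>R y) \<bullet> (c *\<^sub>R v)))) (at y)"
    by (simp add: F_scale[OF assms] power_mult_distrib)
  moreover have "((\<lambda>z. c\<^sup>2 * (F z)\<^sup>2) has_derivative (\<lambda>v. c\<^sup>2 * (2 * (L y \<bullet> v)))) (at y)"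
    by (rule has_derivative_mult_right[OF F2_has_derivative[OF False]])
  ultimately have "(\<lambda>v. 2 * (L (c *\<^sub>R y) \<bullet> (c *\<^sub>R v))) = (\<lambda>v. c\<^sup>2 * (2 * (L y \<bullet> v)))"
    by (rule has_derivative_unique)
  then have "c * (L (c *\<^sub>R y) \<bullet> v) = c * ((c *\<^sub>R L y) \<bullet> v)" for v
    using assms by (simp add: fun_eq_iff power2_eq_square)
  then have "L (c *\<^sub>R y) \<bullet> v = (c *\<^sub>R L y) \<bullet> v" for v
    using assms by simp
  then show ?thesis using vector_eq_rdot by blast
qed simp

text \<open>Euler's identity for the square of \<open>F\<close>, homogeneous of degree 2.\<close>

lemma L_self: "L y \<bullet> y = (F y)\<^sup>2"
proof (cases "y = 0")
  case False
  have "((\<lambda>t. (F (0 + t *\<^sub>R y))\<^sup>2) has_real_derivative 2 * (L y \<bullet> y)) (at 1)"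
    using F2_line_has_derivative[of 0 1 y] False by simp
  then have "((\<lambda>t. t\<^sup>2 * (F y)\<^sup>2) has_real_derivative 2 * (L y \<bullet> y)) (at 1)"
    unfolding has_field_derivative_def
    by (rule has_derivative_transform_within_open[of _ _ _ _ "{0<..}"])
      (auto simp: F_scale power_mult_distrib)
  moreover have "((\<lambda>t. t\<^sup>2 * (F y)\<^sup>2) has_real_derivative 2 * (F y)\<^sup>2) (at 1)"
    by (auto intro!: derivative_eq_intros)
  ultimately show ?thesis using DERIV_unique by fastforce
qed simp

text \<open>Euler's identity for \<open>L\<close>, homogeneous of degree 1.\<close>

lemma G_self: "y \<noteq> 0 \<Longrightarrow> (G y *v y) \<bullet> v = L y \<bullet> v"
proof -
  assume "y \<noteq> 0"
  then have "((\<lambda>t. L (0 + t *\<^sub>R y) \<bullet> v) has_real_derivative (G y *v y) \<bullet> v) (at 1)"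
    using L_line_has_derivative[of 0 1 y] by simp
  then have "((\<lambda>t. t * (L y \<bullet> v)) has_real_derivative (G y *v y) \<bullet> v) (at 1)"
    unfolding has_field_derivative_def
    by (rule has_derivative_transform_within_open[of _ _ _ _ "{0<..}"])
      (auto simp: L_scale)
  moreover have "((\<lambda>t. t * (L y \<bullet> v)) has_real_derivative L y \<bullet> v) (at 1)"
    by (auto intro!: derivative_eq_intros)
  ultimately show ?thesis using DERIV_unique by fastforce
qed

text \<open>By the two Euler identities \<open>(F y)\<^sup>2\<close> is the quadratic form of
  \<open>G y\<close> at \<open>y\<close> itself, hence positive.\<close>

lemma F_pos: "y \<noteq> 0 \<Longrightarrow> 0 < F y"
  using G_pos[of y y] G_self[of y y] L_self[of y] F_nonneg[of y]
  by (metis inner_commute less_eq_real_def order_less_irrefl power2_eq_square mult_zero_left)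

lemma F_eq_0_iff [simp]: "F y = 0 \<longleftrightarrow> y = 0"
  using F_pos F_zero by (metis less_irrefl)

text \<open>Strict convexity of \<open>F\<^sup>2/2\<close>: if the segment from \<open>y\<close> to \<open>w\<close> avoids the origin, apply the mean
  value theorem twice along it; otherwise \<open>w\<close> is a nonpositive multiple of \<open>y\<close>.\<close>

lemma legendre_young:
  assumes "y \<noteq> 0" "w \<noteq> y"
  shows "L y \<bullet> w < ((F y)\<^sup>2 + (F w)\<^sup>2) / 2"
proof (cases "\<exists>t\<in>{0..1}. y + t *\<^sub>R (w - y) = 0")
  case True
  then obtain t where t: "0 \<le> t" "t \<le> 1" "y + t *\<^sub>R (w - y) = 0" by auto
  have "t \<noteq> 0" using t assms by auto
  have "t *\<^sub>R w = (t - 1) *\<^sub>R y" using t(3) by (simp add: algebra_simps)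
  then have "t * (L y \<bullet> w) = (t - 1) * (F y)\<^sup>2"
    by (metis L_self inner_scaleR_right)
  also have "\<dots> \<le> 0" using t by (simp add: mult_le_0_iff)
  finally have "L y \<bullet> w \<le> 0" using t \<open>t \<noteq> 0\<close> by (simp add: mult_le_0_iff)
  moreover have "0 < (F y)\<^sup>2" using assms(1) by simp
  ultimately show ?thesis by (smt (verit) zero_le_power2 divide_pos_pos)
next
  case False
  let ?k = "w - y"
  have nz: "y + t *\<^sub>R ?k \<noteq> 0" if "0 \<le> t" "t \<le> 1" for t using False that by auto
  obtain s where s: "0 < s" "s < 1" "(F (y + 1 *\<^sub>R ?k))\<^sup>2 - (F (y + 0 *\<^sub>R ?k))\<^sup>2
      = (1 - 0) * (2 * (L (y + s *\<^sub>R ?k) \<bullet> ?k))"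
    using MVT2[of 0 1, OF _ F2_line_has_derivative[OF nz]] by auto
  obtain r where r: "0 < r" "r < s" "L (y + s *\<^sub>R ?k) \<bullet> ?k - L (y + 0 *\<^sub>R ?k) \<bullet> ?k
      = (s - 0) * ((G (y + r *\<^sub>R ?k) *v ?k) \<bullet> ?k)"
    using MVT2[of 0 s, OF _ L_line_has_derivative[OF nz]] s by auto
  have "0 < (G (y + r *\<^sub>R ?k) *v ?k) \<bullet> ?k"
    using G_pos[OF nz, of r ?k] r s assms by (simp add: inner_commute)
  then have "0 < L (y + s *\<^sub>R ?k) \<bullet> ?k - L y \<bullet> ?k"
    using r s by simp
  then have "2 * (L y \<bullet> ?k) < (F w)\<^sup>2 - (F y)\<^sup>2"
    using s by simp
  then show ?thesis by (simp add: inner_diff_right L_self)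
qed

lemma L_le: "L y \<bullet> w \<le> F y * F w"
proof (cases "y = 0 \<or> w = 0")
  case False
  \<comment> \<open>Scales \<open>w\<close> to the \<open>F\<close>-length of \<open>y\<close>,
    where the mean of the two squares in \<open>legendre_young\<close> becomes the product of the
    lengths.\<close>
  define c where "c = F y / F w"
  have c: "0 < c" "c * F w = F y" using False F_pos by (auto simp: c_def)
  have "L y \<bullet> (c *\<^sub>R w) \<le> ((F y)\<^sup>2 + (F (c *\<^sub>R w))\<^sup>2) / 2"
    using legendre_young[of y "c *\<^sub>R w"] False L_self by (cases "c *\<^sub>R w = y") auto
  also have "\<dots> = c * (F y * F w)"
    using c by (simp add: F_scale power2_eq_square)
  finally show ?thesis using c by simp
qed auto

text \<open>The sum of the strict Young inequalities for \<open>(y, z)\<close> and for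
  \<open>(z, y)\<close>.\<close>

lemma L_strict_mono: "y \<noteq> 0 \<Longrightarrow> z \<noteq> 0 \<Longrightarrow> y \<noteq> z \<Longrightarrow> 0 < (L y - L z) \<bullet> (y - z)"
  using legendre_young[of y z] legendre_young[of z y]
  by (simp add: inner_diff_left inner_diff_right L_self)

lemma L_inj: "L y = L z \<Longrightarrow> y = z"
  using L_strict_mono[of y z] L_self[of y] L_self[of z] by (cases "y = 0"; cases "z = 0") auto

text \<open>As the Legendre map is injective, \<open>inv\<close> returns whichever preimage of the
  differential is exhibited.\<close>

lemma gradient_eq:
  assumes "\<And>v. blinfun_apply (differential f x) v = L y \<bullet> v"
  shows "gradient F f x = y"
proof -
  have "inj (legendre F)"
    by (rule injI, rule L_inj) (simp add: legendre_vector_def)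
  moreover have "differential f x = legendre F y"
    using assms legendre_eq_iff by metis
  ultimately show ?thesis by (simp add: gradient_def)
qed

section \<open>Comparison with the Euclidean norm, minimizers, surjectivity of the Legendre
  map\<close>

lemma F_bounds:
  obtains c C where "0 < c" "\<And>y. c * norm y \<le> F y" "\<And>y. F y \<le> C * norm y"
proof -
  have co: "continuous_on (sphere 0 1) F"
    by (rule continuous_on_subset[OF F_continuous_nonzero]) auto
  obtain a where a: "a \<in> sphere 0 1" "\<And>y. y \<in> sphere 0 1 \<Longrightarrow> F a \<le> F y"
    using continuous_attains_inf[OF compact_sphere _ co] by auto
  obtain b where b: "b \<in> sphere 0 1" "\<And>y. y \<in> sphere 0 1 \<Longrightarrow> F y \<le> F b"
    using continuous_attains_sup[OF compact_sphere _ co] by auto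
  have e: "F y = norm y * F (y /\<^sub>R norm y)" if "y \<noteq> 0" for y
    using F_scale[of "norm y" "y /\<^sub>R norm y"] that by simp
  have "F a * norm y \<le> F y" "F y \<le> F b * norm y" for y
    using a(2)[of "y /\<^sub>R norm y"] b(2)[of "y /\<^sub>R norm y"] e[of y]
    by (cases "y = 0"; simp add: mult.commute)+
  moreover have "0 < F a" using a(1) by (intro F_pos) auto
  ultimately show ?thesis using that by blast
qed

lemma F_continuous: "continuous_on UNIV F"
proof -
  obtain C where C: "\<And>y. F y \<le> C * norm y" using F_bounds by metis
  have "(F \<longlongrightarrow> 0) (at 0)"
  proof (rule tendsto_sandwich[of "\<lambda>_. 0" F _ "\<lambda>y. C * norm y"])
    show "((\<lambda>y. C * norm y) \<longlongrightarrow> 0) (at 0)"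
      by (auto intro!: tendsto_eq_intros)
  qed (use C F_nonneg in auto)
  then have "isCont F 0" by (simp add: isCont_def)
  moreover have "isCont F y" if "y \<noteq> 0" for y
    using F_has_derivative[OF that] has_derivative_continuous by blast
  ultimately show ?thesis by (metis continuous_at_imp_continuous_on)
qed

text \<open>Coercivity: outside the ball of radius \<open>F a / c\<close> the values of
  \<open>F\<close> exceed \<open>F a\<close>, so a minimum over the compact part of \<open>A\<close>
  is global. Along lines through the minimizer inside \<open>A\<close>, the square of
  \<open>F\<close> has derivative 0 there.\<close>

lemma F_minimizer:
  assumes "closed A" "a \<in> A" "0 \<notin> A"
  obtains y where "y \<in> A" "\<And>z. z \<in> A \<Longrightarrow> F y \<le> F z"
    "\<And>k. (\<And>t. y + t *\<^sub>R k \<in> A) \<Longrightarrow> L y \<bullet> k = 0"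
proof -
  obtain c where c: "0 < c" "\<And>y. c * norm y \<le> F y" using F_bounds by metis
  let ?B = "A \<inter> cball 0 (F a / c)"
  have "compact ?B" using assms(1) compact_cball closed_Int_compact by blast
  moreover have "a \<in> ?B" using assms(2) c(1) c(2)[of a] by (simp add: field_simps)
  ultimately obtain y where y: "y \<in> ?B" "\<And>z. z \<in> ?B \<Longrightarrow> F y \<le> F z"
    using continuous_attains_inf[of ?B F] continuous_on_subset[OF F_continuous] by blast
  have min: "F y \<le> F z" if "z \<in> A" for z
  proof (cases "z \<in> ?B")
    case False
    then have "F a < c * norm z" using that c(1) by (simp add: field_simps)
    then show ?thesis using y(2)[OF \<open>a \<in> ?B\<close>] c(2)[of z] by linarith
  qed (use y in auto)
  have "L y \<bullet> k = 0" if k: "\<And>t. y + t *\<^sub>R k \<in> A" for k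
  proof -
    have "y \<noteq> 0" using y assms by auto
    then have "((\<lambda>t. (F (y + t *\<^sub>R k))\<^sup>2) has_real_derivative 2 * (L y \<bullet> k)) (at 0)"
      using F2_line_has_derivative[of y 0 k] by simp
    moreover have "(F (y + 0 *\<^sub>R k))\<^sup>2 \<le> (F (y + t *\<^sub>R k))\<^sup>2" for t
      using min[OF k] F_nonneg by (simp add: power_mono)
    ultimately have "2 * (L y \<bullet> k) = 0"
      by (intro DERIV_local_min[of "\<lambda>t. (F (y + t *\<^sub>R k))\<^sup>2" _ 0 1]) auto
    then show ?thesis by simp
  qed
  then show ?thesis using that y(1) min by blast
qed

text \<open>Lagrange multipliers: where \<open>F\<close> is least on the hyperplane
  \<open>a \<bullet> y = 1\<close>, the vector \<open>L y\<close> is orthogonal to the hyperplane,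
  hence a multiple of \<open>a\<close>; homogeneity removes the factor.\<close>

lemma L_surj:
  assumes "a \<noteq> 0"
  obtains y where "y \<noteq> 0" "L y = a"
proof -
  let ?A = "{y. a \<bullet> y = 1}"
  have "a /\<^sub>R (a \<bullet> a) \<in> ?A" using assms by simp
  then obtain y where "y \<in> ?A" and y': "\<And>k. (\<And>t. y + t *\<^sub>R k \<in> ?A) \<Longrightarrow> L y \<bullet> k = 0"
    by (rule F_minimizer[OF closed_hyperplane]) simp_all
  then have y: "a \<bullet> y = 1" by simp
  have "y \<noteq> 0" using y by auto
  define c where "c = (F y)\<^sup>2"
  have c: "0 < c" using \<open>y \<noteq> 0\<close> by (simp add: c_def)
  have "L y \<bullet> v = (c *\<^sub>R a) \<bullet> v" for v
  proof -
    have "L y \<bullet> (v - (a \<bullet> v) *\<^sub>R y) = 0"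
      by (rule y') (simp add: inner_add_right inner_diff_right y)
    then show ?thesis by (simp add: inner_diff_right L_self c_def)
  qed
  then have "L y = c *\<^sub>R a" using vector_eq_rdot by blast
  then have "L ((1/c) *\<^sub>R y) = a" using L_scale[of "1/c" y] c by simp
  then show ?thesis using that[of "(1/c) *\<^sub>R y"] \<open>y \<noteq> 0\<close> c by simp
qed

end

section \<open>Quotient metrics\<close>

lemma matrix_inv_right:
  assumes "invertible A"
  shows "A ** matrix_inv A = mat 1"
  using assms unfolding invertible_def matrix_inv_def by (rule someI2_ex) simp

text \<open>The metric \<open>Q\<close> is the pullback along \<open>P\<close> of the quotient metric
  on \<open>V/ker P\<close>: \<open>tau x\<close> is the \<open>F\<close>-shortest vector of the coset \<open>x + ker P\<close>.\<close>

locale minkowski_projection = minkowski_space F for F :: "real^'n \<Rightarrow> real" +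
  fixes P :: "real^'n^'n"
  assumes idem: "P ** P = P"
begin

text \<open>Minimality on the coset is encoded by its first-order condition, that \<open>L y\<close>
  annihilates \<open>ker P\<close>; strict monotonicity of \<open>L\<close> gives
  uniqueness.\<close>

definition tau :: "real^'n \<Rightarrow> real^'n" where
  "tau x = (THE y. P *v y = P *v x \<and> (\<forall>k. P *v k = 0 \<longrightarrow> L y \<bullet> k = 0))"

definition Q :: "real^'n \<Rightarrow> real" where
  "Q x = F (tau x)"

lemma P_P [simp]: "P *v (P *v x) = P *v x"
  by (simp add: matrix_vector_mul_assoc idem)

lemma tau_unique:
  assumes "P *v y = P *v z" "\<And>k. P *v k = 0 \<Longrightarrow> L y \<bullet> k = 0" "\<And>k. P *v k = 0 \<Longrightarrow> L z \<bullet> k = 0"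
  shows "y = z"
proof -
  have "P *v (y - z) = 0"
    using assms(1) by (simp add: matrix_vector_mult_diff_distrib)
  then have k: "L y \<bullet> (y - z) = 0" "L z \<bullet> (y - z) = 0"
    using assms by auto
  then show ?thesis
    using L_strict_mono[of y z] L_self[of y] L_self[of z]
    by (cases "y = 0"; cases "z = 0") (auto simp: inner_diff_left)
qed

lemma closed_fibre: "closed {y. P *v y = c}"
  by (intro closed_Collect_eq continuous_intros matrix_vector_mult_linear_continuous_on)

lemma tau_exists: "\<exists>y. P *v y = P *v x \<and> (\<forall>k. P *v k = 0 \<longrightarrow> L y \<bullet> k = 0)"
proof (cases "P *v x = 0")
  \<comment> \<open>The coset is \<open>ker P\<close>, which contains the origin and so is out of
    reach of \<open>F_minimizer\<close>; here 0 is the solution.\<close>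
  case True
  then show ?thesis by (intro exI[of _ 0]) auto
next
  case False
  let ?A = "{y. P *v y = P *v x}"
  obtain y where y: "y \<in> ?A" and *: "\<And>k. (\<And>t. y + t *\<^sub>R k \<in> ?A) \<Longrightarrow> L y \<bullet> k = 0"
    by (rule F_minimizer[OF closed_fibre, of x "P *v x"]) (use False in auto)
  have "L y \<bullet> k = 0" if "P *v k = 0" for k
    by (rule *) (use y that in \<open>simp add: matrix_vector_right_distrib matrix_vector_mult_scaleR\<close>)
  then show ?thesis using y by blast
qed

lemma tau_eqI: "P *v y = P *v x \<Longrightarrow> (\<And>k. P *v k = 0 \<Longrightarrow> L y \<bullet> k = 0) \<Longrightarrow> tau x = y"
  unfolding tau_def by (rule the_equality) (auto intro: tau_unique)

lemma P_tau [simp]: "P *v tau x = P *v x"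
  and L_tau: "P *v k = 0 \<Longrightarrow> L (tau x) \<bullet> k = 0"
  using tau_exists[of x] tau_eqI by metis+

lemma tau_eq_0_iff [simp]: "tau x = 0 \<longleftrightarrow> P *v x = 0"
  using P_tau[of x] tau_eqI[of 0 x] by (auto simp del: P_tau)

lemma L_tau_cong:
  assumes "P *v v = P *v w"
  shows "L (tau x) \<bullet> v = L (tau x) \<bullet> w"
  using L_tau[of "v - w" x] assms by (simp add: inner_diff_right matrix_vector_mult_diff_distrib)

text \<open>Recovers minimality from the first-order condition: \<open>L (tau x)\<close> has the
  same pairing with every vector of the coset, namely \<open>(F (tau x))\<^sup>2\<close>, and
  \<open>L_le\<close> bounds it.\<close>

lemma Q_le: "P *v z = P *v x \<Longrightarrow> Q x \<le> F z"
proof -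
  assume z: "P *v z = P *v x"
  have "F (tau x) * F (tau x) = L (tau x) \<bullet> z"
    using L_tau_cong[of z "tau x" x] z by (simp add: L_self power2_eq_square)
  also have "\<dots> \<le> F (tau x) * F z" by (rule L_le)
  finally show ?thesis
    using F_nonneg[of "tau x"] F_nonneg[of z]
    by (auto simp: Q_def mult_le_cancel_left simp del: F_eq_0_iff)
qed

lemma Q_eq_0_iff [simp]: "Q x = 0 \<longleftrightarrow> P *v x = 0"
  by (simp add: Q_def)

lemma Q_nonneg: "0 \<le> Q x" by (simp add: Q_def F_nonneg)

lemma Q_pos: "P *v x \<noteq> 0 \<Longrightarrow> 0 < Q x"
  using Q_nonneg[of x] Q_eq_0_iff[of x] by linarith

text \<open>The second summand of \<open>\<Phi> y\<close> lies in \<open>ker P\<close> and vanishes iff \<open>L y\<close> annihilates \<open>ker P\<close>. So both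
  defining conditions of \<open>tau x\<close> are the one equation \<open>\<Phi> (tau x) = P *v x\<close>, to which the inverse
  function theorem applies.\<close>

definition N :: "real^'n^'n" where
  "N = mat 1 - P"

definition \<Phi> :: "real^'n \<Rightarrow> real^'n" where
  "\<Phi> y = P *v y + N *v (transpose N *v L y)"

text \<open>The Jacobian matrix of \<open>\<Phi>\<close>.\<close>

definition M :: "real^'n \<Rightarrow> real^'n^'n" where
  "M y = P + N ** transpose N ** G y"

text \<open>The derivative of \<open>tau\<close> where \<open>tau\<close> has the value
  \<open>y\<close>, obtained by implicit differentiation of
  \<open>\<Phi> (tau x) = P *v x\<close>.\<close>

definition D :: "real^'n \<Rightarrow> real^'n^'n" where
  "D y = matrix_inv (M y) ** P"

lemma N_apply: "N *v v = v - P *v v"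
  by (simp add: N_def matrix_vector_mult_diff_rdistrib)

lemma P_N [simp]: "P *v (N *v v) = 0"
  by (simp add: N_apply matrix_vector_mult_diff_distrib)

lemma inner_transpose_N: "(transpose N *v u) \<bullet> v = u \<bullet> (N *v v)"
  by (simp add: transpose_matrix_vector dot_lmul_matrix)

lemma P_eq_0_iff: "P *v k = 0 \<longleftrightarrow> N *v k = k"
  by (simp add: N_apply)

text \<open>The squared norm of \<open>transpose N *v u\<close> is the pairing of \<open>u\<close>
  with \<open>N *v (transpose N *v u)\<close>, so it vanishes; and \<open>N\<close> fixes
  \<open>ker P\<close>.\<close>

lemma N_transpose_N_inner: "N *v (transpose N *v u) = 0 \<Longrightarrow> P *v k = 0 \<Longrightarrow> u \<bullet> k = 0"
proof -
  assume "N *v (transpose N *v u) = 0" "P *v k = 0"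
  moreover have "(transpose N *v u) \<bullet> (transpose N *v u) = u \<bullet> (N *v (transpose N *v u))"
    by (rule inner_transpose_N)
  ultimately have "transpose N *v u = 0" by simp
  then show ?thesis
    using inner_transpose_N[of u k] \<open>P *v k = 0\<close> by (simp add: P_eq_0_iff)
qed

text \<open>Applying \<open>P\<close> separates the two summands; then \<open>L y - L z\<close>
  annihilates \<open>ker P\<close>, which contains \<open>y - z\<close>, and strict monotonicity
  forces equality.\<close>

lemma \<Phi>_inj: "inj_on \<Phi> (UNIV - {0})"
proof (rule inj_onI)
  fix y z assume yz: "y \<in> UNIV - {0}" "z \<in> UNIV - {0}" and eq: "\<Phi> y = \<Phi> z"
  have "P *v \<Phi> y = P *v \<Phi> z" by (simp add: eq)
  then have p: "P *v y = P *v z" by (simp add: \<Phi>_def matrix_vector_right_distrib)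
  with eq have "N *v (transpose N *v (L y - L z)) = 0"
    by (simp add: \<Phi>_def matrix_vector_mult_diff_distrib)
  moreover have "P *v (y - z) = 0" by (simp add: p matrix_vector_mult_diff_distrib)
  ultimately have "(L y - L z) \<bullet> (y - z) = 0" by (rule N_transpose_N_inner)
  then show "y = z" using L_strict_mono[of y z] yz by auto
qed

lemma \<Phi>_tau: "\<Phi> (tau x) = P *v x"
proof -
  have "(transpose N *v L (tau x)) \<bullet> v = 0" for v
    unfolding inner_transpose_N by (simp add: L_tau)
  then have "transpose N *v L (tau x) = 0" using inner_eq_zero_iff by blast
  then show ?thesis by (simp add: \<Phi>_def)
qed

lemma M_apply: "M y *v v = P *v v + N *v (transpose N *v (G y *v v))"
  by (simp add: M_def matrix_vector_mult_add_rdistrib matrix_vector_mul_assoc matrix_mul_assoc)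

lemma \<Phi>_has_derivative:
  assumes "y \<noteq> 0"
  shows "(\<Phi> has_derivative (*v) (M y)) (at y)"
proof -
  have lin: "((\<lambda>x. A *v g x) has_derivative (\<lambda>v. A *v g' v)) (at y)"
    if "(g has_derivative g') (at y)" for A :: "real^'n^'n" and g g'
    using bounded_linear.has_derivative[OF matrix_vector_mul_bounded_linear that] .
  have "(\<Phi> has_derivative (\<lambda>v. P *v v + N *v (transpose N *v (G y *v v)))) (at y)"
    unfolding \<Phi>_def[abs_def]
    by (intro has_derivative_add lin L_has_derivative assms has_derivative_ident)
  then show ?thesis unfolding M_apply[symmetric] .
qed

text \<open>The linearised injectivity argument, with positive definiteness of \<open>G\<close> in
  place of strict monotonicity.\<close>

lemma M_invertible:
  assumes "y \<noteq> 0"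
  shows "invertible (M y)"
proof -
  have "v = 0" if "M y *v v = 0" for v
  proof -
    have e: "P *v v + N *v (transpose N *v (G y *v v)) = 0" using that by (simp add: M_apply)
    then have "P *v (P *v v + N *v (transpose N *v (G y *v v))) = 0" by simp
    then have p: "P *v v = 0" by (simp add: matrix_vector_right_distrib)
    with e have "(G y *v v) \<bullet> v = 0" by (intro N_transpose_N_inner) auto
    then show "v = 0" using G_pos[OF assms, of v] by (auto simp: inner_commute)
  qed
  then show ?thesis
    by (meson invertible_left_inverse matrix_left_invertible_ker)
qed

lemma M_D: "y \<noteq> 0 \<Longrightarrow> M y *v (D y *v v) = P *v v"
  by (simp add: D_def matrix_vector_mul_assoc matrix_mul_assoc matrix_inv_right[OF M_invertible])

text \<open>The linearised form of \<open>P \<circ> tau = P\<close>.\<close>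

lemma P_D: "y \<noteq> 0 \<Longrightarrow> P *v (D y *v v) = P *v v"
proof -
  assume "y \<noteq> 0"
  then have "P *v (M y *v (D y *v v)) = P *v v" by (simp add: M_D)
  then show ?thesis by (simp add: M_apply matrix_vector_right_distrib)
qed

lemma D_eq_0: "P *v v = 0 \<Longrightarrow> D y *v v = 0"
  by (simp add: D_def flip: matrix_vector_mul_assoc)

lemma open_P_nonzero: "open {x. P *v x \<noteq> 0}"
  using closed_fibre[of 0] by (simp add: closed_def Collect_neg_eq)

lemma tau_has_derivative:
  assumes "P *v x \<noteq> 0"
  shows "(tau has_derivative (*v) (D (tau x))) (at x)"
proof -
  \<comment> \<open>An inverse on all nonzero vectors, so that \<open>tau\<close> is
    \<open>?\<Psi>\<close> after \<open>P\<close> wherever \<open>P *v x\<close> is nonzero.\<close>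
  let ?\<Psi> = "inv_into (UNIV - {0}) \<Phi>" and ?y = "tau x"
  have y: "?y \<noteq> 0" using assms by simp
  have inv: "?\<Psi> (\<Phi> z) = z" if "z \<in> UNIV - {0}" for z
    by (rule inv_into_f_f[OF \<Phi>_inj that])
  have "continuous_on (UNIV - {0}) \<Phi>"
    using \<Phi>_has_derivative has_derivative_continuous
    by (intro continuous_at_imp_continuous_on) blast
  from has_derivative_inverse_strong[OF open_nonzero _ this inv \<Phi>_has_derivative[OF y],
      of "(*v) (matrix_inv (M ?y))"]
  have "(?\<Psi> has_derivative (*v) (matrix_inv (M ?y))) (at (P *v x))"
    using y by (simp add: fun_eq_iff matrix_vector_mul_assoc matrix_inv_right[OF M_invertible] \<Phi>_tau)
  from has_derivative_compose[OF bounded_linear_imp_has_derivative[OF matrix_vector_mul_bounded_linear] this]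
  have "((\<lambda>x. ?\<Psi> (P *v x)) has_derivative (*v) (D ?y)) (at x)"
    by (simp add: D_def matrix_vector_mul_assoc)
  then show ?thesis
    by (rule has_derivative_transform_within_open[OF _ open_P_nonzero])
      (use assms inv in \<open>auto simp: \<Phi>_tau[symmetric]\<close>)
qed

text \<open>\<open>D y *v v\<close> solves the linear system with matrix \<open>M y\<close> and
  constant right-hand side \<open>P *v v\<close>.\<close>

lemma D_smooth: "Ck_on k (UNIV - {0}) (\<lambda>y. (D y *v v) $ m)"
proof (rule Ck_on_solve[OF open_nonzero])
  show "Ck_on k (UNIV - {0}) (\<lambda>y. M y $ i $ j)" for i j
  proof -
    have "(\<lambda>y. M y $ i $ j) = (\<lambda>y. P $ i $ j + (\<Sum>l\<in>UNIV. (N ** transpose N) $ i $ l * G y $ l $ j))"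
      by (simp add: M_def matrix_matrix_mult_def)
    then show ?thesis
      by (auto intro!: Ck_on_add Ck_on_sum Ck_on_mult Ck_on_const open_nonzero G_smooth)
  qed
qed (use M_invertible M_D in auto)

lemma tau_continuous: "continuous_on {x. P *v x \<noteq> 0} tau"
  using tau_has_derivative has_derivative_continuous
  by (intro continuous_at_imp_continuous_on) blast

text \<open>The derivative of \<open>h \<circ> tau\<close> is again of this form, by the formula for the derivative of \<open>tau\<close>.\<close>

lemma smooth_compose_tau:
  fixes h :: "real^'n \<Rightarrow> real"
  assumes "\<And>k. Ck_on k (UNIV - {0}) h"
  shows "Ck_on k {x. P *v x \<noteq> 0} (\<lambda>x. h (tau x))"
  using assms
proof (induction k arbitrary: h)
  case 0
  have "continuous_on (UNIV - {0}) h" using 0[of 0] by simp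
  then show ?case
    using tau_continuous by (auto intro: continuous_on_compose2)
next
  case (Suc k)
  let ?h = "\<lambda>v y. frechet_derivative h (at y) (D y *v v)"
  have h: "(h has_derivative frechet_derivative h (at y)) (at y)" if "y \<noteq> 0" for y
    using Ck_on_SucD(1)[OF Suc.prems] that by auto
  have "Ck_on j (UNIV - {0}) (?h v)" for j v
  proof -
    have "Ck_on j (UNIV - {0}) (\<lambda>y. \<Sum>i\<in>UNIV. (D y *v v) $ i * frechet_derivative h (at y) (axis i 1))"
      by (intro Ck_on_sum Ck_on_mult open_nonzero D_smooth Ck_on_SucD(2)[OF Suc.prems])
    moreover have "?h v y = (\<Sum>i\<in>UNIV. (D y *v v) $ i * frechet_derivative h (at y) (axis i 1))"
      if "y \<in> UNIV - {0}" for y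
      using has_derivative_expand[OF h, of y "D y *v v"] that by simp
    ultimately show ?thesis using Ck_on_cong[OF open_nonzero] by (metis (no_types, lifting))
  qed
  then have "Ck_on k {x. P *v x \<noteq> 0} (\<lambda>x. ?h v (tau x))" for v by (rule Suc.IH)
  moreover have "((\<lambda>x. h (tau x)) has_derivative (\<lambda>v. ?h v (tau x))) (at x)"
    if "x \<in> {x. P *v x \<noteq> 0}" for x
    using has_derivative_compose[OF tau_has_derivative h] that by simp
  ultimately show ?case by (intro Ck_on_SucI[OF open_P_nonzero])
qed

section \<open>Regularity of the quotient metric\<close>

lemma Q_smooth: "Ck_on k {x. P *v x \<noteq> 0} Q"
  using smooth_compose_tau[OF F_smooth] by (simp add: Q_def[abs_def])

text \<open>The factor \<open>D (tau x)\<close> drops out of the chain rule: it moves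
  \<open>v\<close> only within its coset of \<open>ker P\<close>, and \<open>L (tau x)\<close> is
  constant on cosets.\<close>

lemma Q_has_derivative:
  assumes "P *v x \<noteq> 0"
  shows "(Q has_derivative (\<lambda>v. (L (tau x) \<bullet> v) / Q x)) (at x)"
proof -
  have nz: "tau x \<noteq> 0" using assms by simp
  have "frechet_derivative F (at (tau x)) (D (tau x) *v v) = (L (tau x) \<bullet> v) / Q x" for v
    using L_inner[OF nz, of "D (tau x) *v v"] L_tau_cong[OF P_D[OF nz, of v], of x] assms
    by (simp add: Q_def field_simps)
  then show ?thesis
    using has_derivative_compose[OF tau_has_derivative[OF assms] F_has_derivative[OF nz]]
    by (simp add: Q_def[abs_def])
qed

lemma Q_continuous: "continuous_on UNIV Q"
proof -
  have "isCont Q x" for x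
  proof (cases "P *v x = 0")
    \<comment> \<open>Such points are not covered by \<open>Q_has_derivative\<close>; but
      \<open>z - x\<close> lies in the coset of \<open>z\<close>, so \<open>Q z\<close> is squeezed
      between 0 and \<open>F (z - x)\<close>.\<close>
    case True
    have "Q z \<le> F (z - x)" for z
      by (rule Q_le) (simp add: matrix_vector_mult_diff_distrib True)
    moreover have "((\<lambda>z. F (z - x)) \<longlongrightarrow> 0) (at x)"
    proof -
      have "continuous_on UNIV (\<lambda>z. F (z - x))"
        by (auto intro!: continuous_on_compose2[OF F_continuous] continuous_intros)
      then have "isCont (\<lambda>z. F (z - x)) x"
        using continuous_on_eq_continuous_at by blast
      then show ?thesis by (simp add: isCont_def)
    qed
    ultimately have "(Q \<longlongrightarrow> 0) (at x)"
      by (intro tendsto_sandwich[of "\<lambda>_. 0" Q _ "\<lambda>z. F (z - x)"]) (auto simp: Q_nonneg)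
    then show ?thesis using True by (simp add: isCont_def Q_eq_0_iff[THEN iffD2])
  next
    case False
    then show ?thesis using Q_has_derivative has_derivative_continuous by blast
  qed
  then show ?thesis by (metis continuous_at_imp_continuous_on)
qed

end

section \<open>Isoparametric level sets\<close>

text \<open>A linear functional cannot be injective in dimension at least 2. This supplies tangent
  vectors and, for \<open>a = 0\<close>, just a nonzero vector of \<open>W\<close>.\<close>

lemma exists_orthogonal_in_subspace:
  fixes W :: "'a::euclidean_space set"
  assumes "subspace W" "2 \<le> dim W"
  obtains u where "u \<in> W" "u \<noteq> 0" "a \<bullet> u = 0"
proof -
  have "\<not> inj_on ((\<bullet>) a) W"
  proof
    assume "inj_on ((\<bullet>) a) W"
    then have "dim ((\<bullet>) a ` W) = dim W"
      by (intro dim_image_eq)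
        (simp_all add: assms(1) span_eq_iff[THEN iffD2] bounded_linear.linear bounded_linear_inner_right)
    moreover have "dim ((\<bullet>) a ` W) \<le> 1"
      using dim_subset_UNIV[of "(\<bullet>) a ` W"] by simp
    ultimately show False using assms(2) by simp
  qed
  then obtain x y where "x \<in> W" "y \<in> W" "a \<bullet> x = a \<bullet> y" "x \<noteq> y"
    by (auto simp: inj_on_def)
  then show ?thesis
    using that[of "x - y"] assms(1) by (auto simp: subspace_diff inner_diff_right)
qed

text \<open>The factor \<open>\<sigma> / \<sigma>\<close> is 0 rather than 1 when \<open>\<sigma> = 0\<close>.\<close>

lemma divergence_eq:
  assumes "\<And>z. z \<in> U \<Longrightarrow> X z = Y z" "open U" "x \<in> U" "(Y has_derivative Y') (at x)"
  shows "divergence \<sigma> X x = \<sigma> / \<sigma> * (\<Sum>i\<in>UNIV. Y' (axis i 1) $ i)"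
proof -
  have "((\<lambda>z. \<sigma> * X z $ i) has_derivative (\<lambda>v. \<sigma> * Y' v $ i)) (at x)" for i
    by (rule has_derivative_transform_within_open[OF has_derivative_mult_right[OF
          bounded_linear.has_derivative[OF bounded_linear_vec_nth assms(4)]] assms(2,3)])
      (simp add: assms(1))
  then have "partial_deriv i (\<lambda>z. \<sigma> * X z $ i) x = \<sigma> * Y' (axis i 1) $ i" for i
    unfolding partial_deriv_def using frechet_derivative_at by metis
  then show ?thesis by (simp add: divergence_def sum_distrib_left)
qed

lemma smooth_on_const: "smooth_on U (\<lambda>x. c)"
  by (simp add: smooth_on_def Ck_on_const)

context minkowski_space
begin

lemma hyperplane_isoparametric:
  assumes "2 \<le> CARD('n)" "hyperplane N"
  shows "isoparametric_hypersurface_with F \<sigma> 1 N"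
proof -
  obtain a c where a: "a \<noteq> 0" and N: "N = {x. a \<bullet> x = c}"
    using assms(2) by (auto simp: hyperplane_def)
  obtain y where y: "y \<noteq> 0" "L y = a" using L_surj[OF a] .
  define f where "f = (\<lambda>x. a \<bullet> x)"
  have d: "(f has_derivative f) (at x)" for x
    unfolding f_def by (rule bounded_linear_imp_has_derivative[OF bounded_linear_inner_right])
  have df: "blinfun_apply (differential f x) v = a \<bullet> v" for x v
    using differential_apply[OF differentiableI[OF d]] frechet_derivative_at[OF d] by (simp add: f_def)
  have g: "gradient F f = (\<lambda>x. y)"
    using df y by (intro ext gradient_eq) simp
  have reg: "regular_points {} f = UNIV"
    using df a by (auto simp: regular_points_def) (metis blinfun.zero_left inner_eq_zero_iff)
  have "Ck_on k UNIV f" for k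
    by (rule Ck_on_Suc_imp, rule Ck_on_SucI[of UNIV f "\<lambda>x. f"]) (auto intro: d Ck_on_const)
  then have sm: "smooth_on UNIV f" by (simp add: smooth_on_def)
  have "f a \<noteq> f 0" using a by (simp add: f_def)
  then have nc: "\<not> f constant_on UNIV" by (auto simp: constant_on_def) metis
  have lap: "laplacian F \<sigma> f x = 0" for x
    using divergence_eq[of UNIV "\<lambda>x. y" "\<lambda>x. y" x "\<lambda>v. 0" \<sigma>] by (simp add: laplacian_def g)
  have "isoparametric_function F \<sigma> {} f"
    unfolding isoparametric_function_def
    using nc sm reg lap smooth_on_const[of _ "F y"] smooth_on_def[of UNIV f]
    by (intro conjI exI[of _ "\<lambda>x. F y"] exI[of _ "\<lambda>x. 0"]) (auto simp: g dest: spec[of _ 0])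
  moreover have "regular_level_surface {} f N"
  proof -
    have "N = f -` {c}" by (auto simp: N f_def)
    moreover have "(c / (a \<bullet> a)) *\<^sub>R a \<in> N" using a by (simp add: N)
    ultimately show ?thesis by (auto simp: regular_level_surface_def reg)
  qed
  moreover have "principal_curvatures F f x = {0}" for x
  proof -
    \<comment> \<open>A nonzero tangent vector, so that the eigenvalue 0 really occurs.\<close>
    obtain u where u: "u \<noteq> 0" "a \<bullet> u = 0"
      using exists_orthogonal_in_subspace[of UNIV a] assms(1) by auto
    have "frechet_derivative (unit_normal F f) (at x) X = 0" for X
      by (simp add: unit_normal_def[abs_def] g)
    then show ?thesis using u by (auto simp: principal_curvatures_def df)
  qed
  ultimately show ?thesis
    unfolding isoparametric_hypersurface_with_def
    by (intro exI[of _ "{}"] exI[of _ f] conjI exI[of _ "{0}"]) auto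
qed

end

section \<open>Level sets of the quotient metric\<close>

context minkowski_projection
begin

text \<open>\<open>D y ** P = D y\<close> and \<open>P ** D y = P\<close>, and the trace does not
  see the order of the factors.\<close>

lemma trace_D: "y \<noteq> 0 \<Longrightarrow> (\<Sum>i\<in>UNIV. (D y *v axis i 1) $ i) = trace P"
proof -
  assume y: "y \<noteq> 0"
  have "D y ** P = D y" by (simp add: D_def idem flip: matrix_mul_assoc)
  moreover have "P ** D y = P"
    by (simp add: matrix_eq flip: matrix_vector_mul_assoc) (simp add: P_D[OF y])
  ultimately have "trace (D y) = trace P" by (metis trace_mul_sym)
  then show ?thesis by (simp add: trace_def matrix_vector_mult_basis column_def)
qed

lemma level_set_isoparametric:
  assumes dim: "2 \<le> dim (range ((*v) P))" and r: "0 < r" and eps: "\<epsilon> = 1 \<or> \<epsilon> = -1"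
  shows "isoparametric_hypersurface_with F \<sigma> (if inj ((*v) P) then 1 else 2)
    {x. Q (\<epsilon> *\<^sub>R (x - x0)) = r}"
    (is "isoparametric_hypersurface_with F \<sigma> _ ?N")
proof -
  define z where "z = (\<lambda>x. \<epsilon> *\<^sub>R (x - x0))"
  \<comment> \<open>The outer \<open>\<epsilon>\<close> cancels the one from the chain rule, so
    \<open>df\<close> is \<open>dQ\<close> at \<open>z x\<close> and its Legendre preimage is known
    even for non-reversible \<open>F\<close>.\<close>
  define f where "f = (\<lambda>x. \<epsilon> * Q (z x))"
  \<comment> \<open>The affine subspace where \<open>z x\<close> falls into \<open>ker P\<close>,
    that is, the zero set of \<open>f\<close>.\<close>
  define S where "S = {x. P *v x = P *v x0}"
  have e2: "\<epsilon> * \<epsilon> = 1" "\<epsilon> \<noteq> 0" using eps by auto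
  have zS: "P *v z x \<noteq> 0" if "x \<notin> S" for x
    using that e2 by (simp add: z_def S_def matrix_vector_mult_scaleR matrix_vector_mult_diff_distrib)
  have closedS: "closed S" unfolding S_def by (rule closed_fibre)
  then have openS: "open (UNIV - S)" by auto
  obtain w where w: "w \<in> range ((*v) P)" "w \<noteq> 0"
    by (rule exists_orthogonal_in_subspace[OF _ dim, of 0])
      (simp_all add: linear_subspace_image matrix_vector_mul_linear)
  then have Pw: "P *v w = w" by auto

  have zd: "(z has_derivative (\<lambda>v. \<epsilon> *\<^sub>R v)) (at x)" for x
    unfolding z_def by (auto intro!: derivative_eq_intros)
  have fd: "(f has_derivative (\<lambda>v. (L (tau (z x)) \<bullet> v) / Q (z x))) (at x)" if "x \<notin> S" for x
    using has_derivative_mult_right[OF has_derivative_compose[OF zd Q_has_derivative[OF zS[OF that]]], of \<epsilon>]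
      e2 by (simp add: f_def mult.assoc[symmetric])
  have df: "blinfun_apply (differential f x) v = (L (tau (z x)) \<bullet> v) / Q (z x)" if "x \<notin> S" for x v
    using differential_apply[OF differentiableI[OF fd[OF that]]] frechet_derivative_at[OF fd[OF that]]
    by metis

  define n where "n = (\<lambda>x. (1 / Q (z x)) *\<^sub>R tau (z x))"
  have g: "gradient F f x = n x" if "x \<notin> S" for x
    using Q_pos[OF zS[OF that]] by (intro gradient_eq) (simp add: n_def L_scale df that)
  have Fn: "F (n x) = 1" if "x \<notin> S" for x
    using Q_pos[OF zS[OF that]] zS[OF that] by (simp add: n_def F_scale flip: Q_def)
  \<comment> \<open>In the cube, two factors come from differentiating the reciprocal of
    \<open>Q\<close> and one from \<open>dQ\<close>.\<close>
  define n' where "n' = (\<lambda>x v. (\<epsilon> / Q (z x)) *\<^sub>R (D (tau (z x)) *v v)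
      - (\<epsilon> * (L (tau (z x)) \<bullet> v) / Q (z x) ^ 3) *\<^sub>R tau (z x))"
  have nd: "(n has_derivative n' x) (at x)" if "x \<notin> S" for x
  proof -
    have q: "Q (z x) \<noteq> 0" using zS[OF that] by simp
    have Qd: "((\<lambda>x. 1 / Q (z x)) has_derivative
        (\<lambda>v. - (\<epsilon> * (L (tau (z x)) \<bullet> v) / Q (z x) ^ 3))) (at x)"
      using has_derivative_divide[OF has_derivative_const
          has_derivative_compose[OF zd Q_has_derivative[OF zS[OF that]]] q, of 1] q
      by (simp add: field_simps power3_eq_cube)
    have td: "((\<lambda>x. tau (z x)) has_derivative (\<lambda>v. \<epsilon> *\<^sub>R (D (tau (z x)) *v v))) (at x)"
      using has_derivative_compose[OF zd tau_has_derivative[OF zS[OF that]]]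
      by (simp add: matrix_vector_mult_scaleR)
    show ?thesis
      using has_derivative_scaleR[OF Qd td] by (simp add: n_def n'_def)
  qed

  have reg: "regular_points S f = UNIV - S"
  proof -
    have "differential f x \<noteq> 0" if "x \<notin> S" for x
    proof
      assume "differential f x = 0"
      then have "(L (tau (z x)) \<bullet> tau (z x)) / Q (z x) = 0"
        using df[OF that, of "tau (z x)"] by simp
      then show False using zS[OF that] by (simp add: L_self flip: Q_def)
    qed
    then show ?thesis by (auto simp: regular_points_def)
  qed

  have lap: "laplacian F \<sigma> f x = \<sigma> / \<sigma> * ((trace P - 1) / f x)" if "x \<notin> S" for x
  proof -
    have q: "0 < Q (z x)" "tau (z x) \<noteq> 0" using Q_pos zS[OF that] by auto
    \<comment> \<open>The rank-one part of \<open>n'\<close> has trace proportional to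
      \<open>L (tau (z x)) \<bullet> tau (z x)\<close>, the square of \<open>Q (z x)\<close>; it
      accounts for the \<open>- 1\<close> next to \<open>trace P\<close>.\<close>
    have "(\<Sum>i\<in>UNIV. n' x (axis i 1) $ i) = (\<epsilon> / Q (z x)) * (\<Sum>i\<in>UNIV. (D (tau (z x)) *v axis i 1) $ i)
        - \<epsilon> / Q (z x) ^ 3 * (L (tau (z x)) \<bullet> tau (z x))"
      by (simp add: n'_def sum_subtractf sum_distrib_left inner_axis inner_vec_def[of "L _" "tau _"] mult.assoc)
    also have "\<dots> = (trace P - 1) / f x"
      using q eps unfolding trace_D[OF q(2)] L_self Q_def[symmetric]
      by (auto simp: f_def field_simps power2_eq_square power3_eq_cube)
    finally show ?thesis
      using divergence_eq[of "UNIV - S" "gradient F f" n x "n' x" \<sigma>] g openS nd[OF that] that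
      by (simp add: laplacian_def)
  qed

  have N_level: "?N = f -` {\<epsilon> * r}"
    using e2 by (auto simp: f_def z_def)
  have N_S: "x \<notin> S" if "x \<in> ?N" for x
  proof
    assume "x \<in> S"
    then have "P *v z x = 0"
      by (simp add: z_def S_def matrix_vector_mult_scaleR matrix_vector_mult_diff_distrib)
    then have "Q (z x) = 0" by simp
    moreover have "Q (z x) = r" using that by (simp add: z_def)
    ultimately show False using r by linarith
  qed
  have N_ne: "?N \<noteq> {}"
  proof -
    \<comment> \<open>A vector fixed by \<open>tau\<close>, rescaled to \<open>F\<close>-length
      \<open>r\<close>.\<close>
    let ?y = "(r / Q w) *\<^sub>R tau w"
    have q: "0 < Q w" using w Pw by (intro Q_pos) simp
    have "tau ?y = ?y"
      using q r by (intro tau_eqI) (auto simp: L_scale L_tau)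
    then have "Q ?y = r / Q w * Q w" using q r by (simp add: Q_def F_scale del: F_eq_0_iff)
    then have "Q ?y = r" using q by (simp del: Q_eq_0_iff)
    then have "x0 + \<epsilon> *\<^sub>R ?y \<in> ?N" using eps by auto
    then show ?thesis by blast
  qed

  have nonconst: "\<not> f constant_on UNIV"
  proof -
    obtain x where x: "x \<in> ?N" using N_ne by blast
    moreover have "Q 0 = 0" by simp
    ultimately have "f x \<noteq> f x0" using e2 r by (auto simp: f_def z_def simp del: Q_eq_0_iff)
    then show ?thesis by (auto simp: constant_on_def) metis
  qed
  have cont: "continuous_on UNIV f"
    unfolding f_def z_def
    by (intro continuous_on_mult continuous_on_compose2[OF Q_continuous] continuous_intros) auto
  have neg: "negligible S"
  proof -
    \<comment> \<open>A nonzero row of \<open>P\<close> gives a hyperplane containing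
      \<open>S\<close>.\<close>
    obtain i where "w $ i \<noteq> 0" using w(2) by (auto simp: vec_eq_iff)
    then have "(P *v w) $ i \<noteq> 0" using Pw by simp
    then have "row i P \<noteq> 0" by (auto simp: matrix_vector_mul_component row_def)
    moreover have "S \<subseteq> {x. row i P \<bullet> x = (P *v x0) $ i}"
      by (auto simp: S_def matrix_vector_mul_component row_def vec_eq_iff)
    ultimately show ?thesis using negligible_hyperplane negligible_subset by blast
  qed
  have smooth: "smooth_on (UNIV - S) f"
  proof -
    have "Ck_on k (UNIV - S) (\<lambda>x. \<epsilon> * Q (\<epsilon> *\<^sub>R x + (- \<epsilon> *\<^sub>R x0)))" for k
      using zS
      by (intro Ck_on_mult Ck_on_const openS Ck_on_affine[OF _ openS Q_smooth] bounded_linear_scaleR_right)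
        (auto simp: z_def scaleR_diff_right)
    then show ?thesis by (simp add: smooth_on_def f_def z_def scaleR_diff_right)
  qed
  have isop: "isoparametric_function F \<sigma> S f"
    unfolding isoparametric_function_def reg
  proof (intro conjI exI ballI)
    show "continuous_on (f ` (UNIV - S)) (\<lambda>t. \<sigma> / \<sigma> * ((trace P - 1) / t))"
      using zS e2 by (intro continuous_intros) (auto simp: f_def)
  qed (use nonconst cont closedS neg smooth smooth_on_const[of _ 1] g Fn lap in auto)

  have pc: "principal_curvatures F f x = (if inj ((*v) P) then {- \<epsilon> / r} else {0, - \<epsilon> / r})"
    if x: "x \<in> ?N" for x
  proof -
    let ?y = "tau (z x)"
    have xS: "x \<notin> S" using N_S x by blast
    have Qr: "Q (z x) = r" using x by (simp add: z_def)
    have y: "?y \<noteq> 0" using zS[OF xS] by simp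
    have "(unit_normal F f has_derivative n' x) (at x)"
      by (rule has_derivative_transform_within_open[OF nd[OF xS] openS]) (use xS g Fn in \<open>auto simp: unit_normal_def\<close>)
    then have un: "frechet_derivative (unit_normal F f) (at x) = n' x"
      using frechet_derivative_at by metis
    \<comment> \<open>On tangent vectors the rank-one part of \<open>n'\<close> vanishes, leaving a
      multiple of \<open>D ?y\<close>.\<close>
    have mem: "\<kappa> \<in> principal_curvatures F f x \<longleftrightarrow>
        (\<exists>X. X \<noteq> 0 \<and> L ?y \<bullet> X = 0 \<and> - (\<epsilon> / r) *\<^sub>R (D ?y *v X) = \<kappa> *\<^sub>R X)" for \<kappa>
      using r by (auto simp: principal_curvatures_def df[OF xS] un n'_def Qr)
    have "\<kappa> = - \<epsilon> / r \<or> \<kappa> = 0 \<and> \<not> inj ((*v) P)" if "\<kappa> \<in> principal_curvatures F f x" for \<kappa>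
    proof -
      from that[unfolded mem]
      obtain X where X: "X \<noteq> 0" "- (\<epsilon> / r) *\<^sub>R (D ?y *v X) = \<kappa> *\<^sub>R X" by blast
      show ?thesis
      proof (cases "P *v X = 0")
        case True
        then have "\<kappa> = 0" using X D_eq_0[OF True] by simp
        moreover have "\<not> inj ((*v) P)"
          using True X(1) injD[of "(*v) P" X 0] by auto
        ultimately show ?thesis by blast
      next
        case False
        \<comment> \<open>Modulo \<open>ker P\<close> the map \<open>D ?y\<close> is the identity,
          so applying \<open>P\<close> reads off the eigenvalue.\<close>
        have "P *v (- (\<epsilon> / r) *\<^sub>R (D ?y *v X)) = P *v (\<kappa> *\<^sub>R X)" using X(2) by simp
        then have "(- (\<epsilon> / r)) *\<^sub>R (P *v X) = \<kappa> *\<^sub>R (P *v X)"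
          by (simp only: matrix_vector_mult_scaleR P_D[OF y])
        then have "- (\<epsilon> / r) = \<kappa>" using False by (simp only: scaleR_cancel_right) simp
        then show ?thesis by simp
      qed
    qed
    moreover have "- \<epsilon> / r \<in> principal_curvatures F f x"
    proof -
      obtain u where u: "u \<in> range ((*v) P)" "u \<noteq> 0" "L ?y \<bullet> u = 0"
        by (rule exists_orthogonal_in_subspace[OF _ dim])
          (simp_all add: linear_subspace_image matrix_vector_mul_linear)
      then have Pu: "P *v u = u" by auto
      \<comment> \<open>\<open>?X\<close> and \<open>u\<close> share a coset of
        \<open>ker P\<close>: hence \<open>?X\<close> is still tangent, and \<open>D ?y\<close>,
        which kills \<open>ker P\<close>, fixes it.\<close>
      let ?X = "D ?y *v u"
      have PX: "P *v ?X = P *v u" by (rule P_D[OF y])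
      have "L ?y \<bullet> ?X = 0" using L_tau_cong[OF PX] u by simp
      moreover have "?X \<noteq> 0" using PX Pu u by auto
      moreover have "P *v (?X - u) = 0" using PX by (simp add: matrix_vector_mult_diff_distrib)
      then have "D ?y *v (?X - u) = 0" by (rule D_eq_0)
      then have "D ?y *v ?X = ?X" by (simp add: matrix_vector_mult_diff_distrib)
      ultimately show ?thesis unfolding mem by (intro exI[of _ ?X]) simp
    qed
    moreover have "0 \<in> principal_curvatures F f x" if "\<not> inj ((*v) P)"
    proof -
      from that obtain k where "k \<noteq> 0" "P *v k = 0"
        unfolding linear_injective_0[OF matrix_vector_mul_linear] by blast
      then show ?thesis unfolding mem by (intro exI[of _ k]) (simp add: L_tau D_eq_0)
    qed
    ultimately show ?thesis by auto
  qed

  have "regular_level_surface S f ?N"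
    unfolding regular_level_surface_def reg using N_level N_ne N_S by blast
  moreover have "card (if inj ((*v) P) then {- \<epsilon> / r} else {0, - \<epsilon> / r}) = (if inj ((*v) P) then 1 else 2)"
    using e2 r by auto
  ultimately show ?thesis
    unfolding isoparametric_hypersurface_with_def using isop pc
    by (intro exI[of _ S] exI[of _ f] conjI exI[of _ "if inj ((*v) P) then {- \<epsilon> / r} else {0, - \<epsilon> / r}"]) auto
qed

end

section \<open>Orthogonal projections and cylinders\<close>

locale euclidean_subspace =
  fixes ip :: "real^'n \<Rightarrow> real^'n \<Rightarrow> real" and W :: "(real^'n) set"
  assumes ip: "euclidean_inner_product ip" and W: "subspace W"
begin

lemma bilinear: "bilinear ip"
  and ip_commute: "ip x y = ip y x"
  and ip_pos: "x \<noteq> 0 \<Longrightarrow> 0 < ip x x"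
  using ip by (auto simp: euclidean_inner_product_def)

lemmas ip_simps =
  bilinear_ladd[OF bilinear] bilinear_radd[OF bilinear] bilinear_lsub[OF bilinear]
  bilinear_rsub[OF bilinear] bilinear_lmul[OF bilinear] bilinear_rmul[OF bilinear]
  bilinear_lzero[OF bilinear] bilinear_rzero[OF bilinear]

lemma ip_eq_0: "ip x x = 0 \<Longrightarrow> x = 0"
  using ip_pos[of x] by fastforce

text \<open>\<open>g\<close> is the Gram operator of \<open>ip\<close>; positive definiteness makes
  it injective, hence surjective.\<close>

lemma obtain_gram:
  obtains g where "linear g" "surj g" "\<And>x y. ip x y = x \<bullet> g y"
proof -
  have 1: "ip x y = x \<bullet> (\<Sum>b\<in>Basis. ip b y *\<^sub>R b)" for x y
  proof -
    have "linear (\<lambda>x. ip x y)" using bilinear by (simp add: bilinear_def)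
    then have "ip (\<Sum>b\<in>Basis. (x \<bullet> b) *\<^sub>R b) y = (\<Sum>b\<in>Basis. (x \<bullet> b) * ip b y)"
      by (simp add: linear_sum[where f = "\<lambda>x. ip x y"] linear_scale[where f = "\<lambda>x. ip x y"])
    then show ?thesis by (simp add: euclidean_representation inner_sum_right mult.commute)
  qed
  let ?g = "\<lambda>y. \<Sum>b\<in>Basis. ip b y *\<^sub>R b"
  have 2: "linear ?g"
    by (rule linearI) (simp_all add: ip_simps scaleR_add_left sum.distrib scaleR_sum_right)
  have "x = 0" if "?g x = 0" for x
    using 1[of x x] that ip_eq_0 by simp
  then have "surj ?g"
    using 2 by (intro linear_inj_imp_surj) (auto simp: linear_injective_0)
  then show ?thesis using that 1 2 by blast
qed

lemma orth_unique:
  assumes "u \<in> W" "u' \<in> W" "\<And>w. w \<in> W \<Longrightarrow> ip w (x - u) = 0" "\<And>w. w \<in> W \<Longrightarrow> ip w (x - u') = 0"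
  shows "u = u'"
proof -
  have "u - u' \<in> W" using assms W by (simp add: subspace_diff)
  then have "ip (u - u') (u - u') = ip (u - u') (x - u') - ip (u - u') (x - u)"
    by (simp add: ip_simps)
  also have "\<dots> = 0" using assms \<open>u - u' \<in> W\<close> by simp
  finally show ?thesis using ip_eq_0[of "u - u'"] by simp
qed

text \<open>With \<open>p\<close> the standard orthogonal projection onto \<open>W\<close> and \<open>ip x y = x \<bullet> g y\<close>, the compression
  \<open>p \<circ> g\<close> of \<open>g\<close> to \<open>W\<close> is positive definite; \<open>?T\<close> extends it by the identity on the orthogonal
  complement.\<close>

lemma orth_exists: "\<exists>u. u \<in> W \<and> (\<forall>w\<in>W. ip w (x - u) = 0)"
proof -
  obtain g where g: "linear g" "\<And>x y. ip x y = x \<bullet> g y"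
    using obtain_gram by metis
  obtain B where B: "pairwise orthogonal B" "span B = W"
    using orthonormal_basis_subspace[OF W] by metis
  define p where "p = (\<lambda>x. \<Sum>b\<in>B. (b \<bullet> x / (b \<bullet> b)) *\<^sub>R b)"
  have pW: "p x \<in> W" for x
    using B(2) unfolding p_def by (metis (no_types, lifting) span_base span_scale span_sum)
  have po: "w \<bullet> p x = w \<bullet> x" if "w \<in> W" for w x
    using Gram_Schmidt_step[OF B(1), of w x] that B(2) by (simp add: orthogonal_def p_def inner_diff_right)
  have p: "linear p"
    unfolding p_def
    by (rule linearI)
      (simp_all add: inner_add_right add_divide_distrib scaleR_add_left sum.distrib scaleR_sum_right)
  let ?T = "\<lambda>u. p (g (p u)) + (u - p u)"
  have "linear (\<lambda>u. p (g (p u)))"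
    using linear_compose[OF linear_compose[OF p g(1)] p] by (simp add: o_def)
  then have T: "linear ?T"
    using p by (intro linear_compose_add linear_compose_sub linear_ident)
  have wT: "w \<bullet> ?T u = ip w (p u)" if "w \<in> W" for w u
    by (simp add: inner_add_right inner_diff_right po that g(2))
  have "u = 0" if "?T u = 0" for u
  proof -
    have "ip (p u) (p u) = 0" using wT[OF pW, of u u] that by simp
    then have "p u = 0" by (rule ip_eq_0)
    then show "u = 0" using that p g by (simp add: linear_0)
  qed
  then have "inj ?T" using linear_injective_0[OF T] by blast
  then have "surj ?T" using T linear_inj_imp_surj by blast
  then obtain v where v: "p (g x) = ?T v" by (rule surjE)
  have "ip w (x - p v) = 0" if "w \<in> W" for w
    using wT[OF that, of v] po[OF that, of "g x"] unfolding v[symmetric] by (simp add: g(2)[of w x] ip_simps)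
  then show ?thesis using pW by blast
qed

abbreviation proj :: "real^'n \<Rightarrow> real^'n" where "proj \<equiv> orth_projection ip W"

lemma proj_eqI: "u \<in> W \<Longrightarrow> (\<And>w. w \<in> W \<Longrightarrow> ip w (x - u) = 0) \<Longrightarrow> proj x = u"
  unfolding orth_projection_def by (rule the_equality) (auto intro: orth_unique)

lemma proj_in: "proj x \<in> W"
  and proj_orth: "w \<in> W \<Longrightarrow> ip w (x - proj x) = 0"
  using orth_exists[of x] proj_eqI by metis+

lemma proj_id: "w \<in> W \<Longrightarrow> proj w = w"
  by (rule proj_eqI) (auto simp: ip_simps)

lemma proj_linear: "linear proj"
proof (rule linearI)
  show "proj (x + y) = proj x + proj y" for x y
  proof (rule proj_eqI)
    show "ip w (x + y - (proj x + proj y)) = 0" if "w \<in> W" for w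
      using proj_orth[OF that, of x] proj_orth[OF that, of y] by (simp add: ip_simps)
  qed (simp add: W proj_in subspace_add)
  show "proj (c *\<^sub>R x) = c *\<^sub>R proj x" for c x
  proof (rule proj_eqI)
    show "ip w (c *\<^sub>R x - c *\<^sub>R proj x) = 0" if "w \<in> W" for w
      using proj_orth[OF that, of x] by (simp add: ip_simps)
  qed (simp add: W proj_in subspace_scale)
qed

definition proj_matrix :: "real^'n^'n" where "proj_matrix = matrix proj"

lemma proj_matrix_apply: "proj_matrix *v x = proj x"
  by (simp add: proj_matrix_def matrix_works proj_linear)

lemma proj_matrix_idem: "proj_matrix ** proj_matrix = proj_matrix"
  by (simp add: matrix_eq proj_matrix_apply proj_id proj_in flip: matrix_vector_mul_assoc)

lemma range_proj: "range proj = W"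
  using proj_in proj_id by (metis image_subset_iff subsetI subset_antisym rangeI)

text \<open>Describes the dual subspace without representing vectors: its covectors factor through
  the projection. Conversely, self-adjointness of \<open>proj\<close> moves it onto the representing
  vector.\<close>

lemma dual_subspace_iff:
  "\<xi> \<in> dual_subspace ip W \<longleftrightarrow> (\<forall>v. blinfun_apply \<xi> (proj v) = blinfun_apply \<xi> v)"
proof
  assume "\<xi> \<in> dual_subspace ip W"
  then obtain w where w: "w \<in> W" "\<And>y. blinfun_apply \<xi> y = ip w y"
    by (auto simp: dual_subspace_def)
  then show "\<forall>v. blinfun_apply \<xi> (proj v) = blinfun_apply \<xi> v"
    using proj_orth[OF w(1)] by (simp add: ip_simps)
next
  assume *: "\<forall>v. blinfun_apply \<xi> (proj v) = blinfun_apply \<xi> v"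
  obtain g where g: "surj g" "\<And>x y. ip x y = x \<bullet> g y"
    using obtain_gram by metis
  obtain a where a: "g a = (\<chi> i. blinfun_apply \<xi> (axis i 1))" using g(1) by (metis surjD)
  have "blinfun_apply \<xi> v = ip a v" for v
    using has_derivative_expand[OF bounded_linear_imp_has_derivative[OF blinfun.bounded_linear_right], of \<xi> v]
    by (simp add: ip_commute[of a v] g(2)[of v a] a inner_vec_def)
  moreover have "ip a (proj v) = ip (proj a) v" for v
    using proj_orth[OF proj_in, of v a] proj_orth[OF proj_in, of a v]
    by (simp add: ip_simps ip_commute)
  ultimately have "blinfun_apply \<xi> v = ip (proj a) v" for v using * by metis
  then show "\<xi> \<in> dual_subspace ip W"
    using proj_in unfolding dual_subspace_def by blast
qed

end

section \<open>Duality, and the cylinder metric as a quotient metric\<close>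

context minkowski_space
begin

text \<open>\<open>L_le\<close> bounds every quotient in the supremum, and \<open>y\<close> itself
  attains the bound.\<close>

lemma dual_metric_L:
  assumes "y \<noteq> 0" "\<And>v. blinfun_apply \<xi> v = L y \<bullet> v"
  shows "dual_metric F \<xi> = F y"
  unfolding dual_metric_def
proof (rule cSup_eq_maximum)
  show "F y \<in> (\<lambda>v. blinfun_apply \<xi> v / F v) ` (UNIV - {0})"
    by (rule image_eqI[of _ _ y]) (use assms L_self[of y] in \<open>auto simp: power2_eq_square\<close>)
  show "t \<le> F y" if t: "t \<in> (\<lambda>v. blinfun_apply \<xi> v / F v) ` (UNIV - {0})" for t
  proof -
    from t obtain v where "v \<noteq> 0" "t = (L y \<bullet> v) / F v" by (auto simp: assms(2))
    then show ?thesis using L_le[of y v] by (simp add: pos_divide_le_eq F_pos)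
  qed
qed

lemma obtain_L:
  assumes "\<xi> \<noteq> 0"
  obtains y where "y \<noteq> 0" "\<And>v. blinfun_apply \<xi> v = L y \<bullet> v"
proof -
  have e: "blinfun_apply \<xi> v = (\<chi> i. blinfun_apply \<xi> (axis i 1)) \<bullet> v" for v
    using has_derivative_expand[OF bounded_linear_imp_has_derivative[OF blinfun.bounded_linear_right], of \<xi> v]
    by (simp add: inner_vec_def mult.commute)
  have "(\<chi> i. blinfun_apply \<xi> (axis i 1)) \<noteq> 0"
  proof
    assume "(\<chi> i. blinfun_apply \<xi> (axis i 1)) = 0"
    then have "blinfun_apply \<xi> v = 0" for v using e[of v] by simp
    then show False using assms by (auto intro: blinfun_eqI)
  qed
  then show ?thesis using that e by (metis L_surj)
qed

text \<open>A covector of the dual subspace has the same value at \<open>E.proj x\<close> as at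
  \<open>Pr.tau x\<close>, so writing it as \<open>L v\<close> and using \<open>L_le\<close> bounds
  the supremum by \<open>Pr.Q x\<close>; the covector of \<open>Pr.tau x\<close> attains it.\<close>

lemma cylinder_metric_eq:
  fixes W :: "(real^'n) set"
  assumes ip: "euclidean_inner_product ip" and W: "subspace W" "W \<noteq> {0}"
  shows "cylinder_metric F ip W (orth_projection ip W x)
    = minkowski_projection.Q F (euclidean_subspace.proj_matrix ip W) x"
proof -
  interpret E: euclidean_subspace ip W using ip W(1) by unfold_locales
  interpret Pr: minkowski_projection F E.proj_matrix
    by unfold_locales (rule E.proj_matrix_idem)
  note PE = E.proj_matrix_apply
  obtain w where w: "w \<in> W" "w \<noteq> 0" using W subspace_0 by blast
  \<comment> \<open>When \<open>E.proj x = 0\<close> all quotients are 0 but \<open>Pr.tau x\<close>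
    gives the zero covector, which is excluded; \<open>w\<close> then supplies a nonzero
    one.\<close>
  define x' where "x' = (if E.proj x = 0 then w else x)"
  have x': "E.proj x' \<noteq> 0" using w by (simp add: x'_def E.proj_id)
  define y where "y = Pr.tau x'"
  have y: "y \<noteq> 0" using x' by (simp add: y_def PE)
  have Ly: "L y \<bullet> E.proj v = L y \<bullet> v" for v
    unfolding y_def by (rule Pr.L_tau_cong) (simp add: PE E.proj_id E.proj_in)
  define \<eta> where "\<eta> = legendre F y"
  have \<eta>: "blinfun_apply \<eta> v = L y \<bullet> v" for v by (simp add: \<eta>_def legendre_apply)
  have max: "blinfun_apply \<eta> (E.proj x) / dual_metric F \<eta> = Pr.Q x"
  proof (cases "E.proj x = 0")
    case True
    then show ?thesis by (simp add: blinfun.zero_right Pr.Q_eq_0_iff[THEN iffD2] PE)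
  next
    case False
    then have "x' = x" by (simp add: x'_def)
    then have "L y \<bullet> E.proj x = L y \<bullet> y"
      using Pr.P_tau[of x] unfolding y_def by (intro Pr.L_tau_cong) (simp add: PE E.proj_id E.proj_in)
    then show ?thesis
      using y \<open>x' = x\<close> by (simp add: dual_metric_L[OF y \<eta>] \<eta> L_self y_def Pr.Q_def power2_eq_square)
  qed
  show ?thesis
    unfolding cylinder_metric_def
  proof (rule cSup_eq_maximum)
    have "\<eta> \<in> dual_subspace ip W" by (simp add: E.dual_subspace_iff \<eta> Ly)
    moreover have "\<eta> \<noteq> 0" using \<eta>[of y] y L_self[of y] by auto
    ultimately show "Pr.Q x \<in> (\<lambda>\<xi>. blinfun_apply \<xi> (E.proj x) / dual_metric F \<xi>) ` (dual_subspace ip W - {0})"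
      using max by (metis (no_types, lifting) DiffI image_eqI singletonD)
  next
    fix t assume "t \<in> (\<lambda>\<xi>. blinfun_apply \<xi> (E.proj x) / dual_metric F \<xi>) ` (dual_subspace ip W - {0})"
    then obtain \<xi> where \<xi>: "\<xi> \<in> dual_subspace ip W" "\<xi> \<noteq> 0"
      and t: "t = blinfun_apply \<xi> (E.proj x) / dual_metric F \<xi>" by auto
    obtain v where v: "v \<noteq> 0" "\<And>u. blinfun_apply \<xi> u = L v \<bullet> u" by (rule obtain_L[OF \<xi>(2)]) metis
    have "blinfun_apply \<xi> (E.proj x) = blinfun_apply \<xi> (E.proj (Pr.tau x))"
      using Pr.P_tau[of x] by (simp add: PE)
    also have "\<dots> = L v \<bullet> Pr.tau x"
      using \<xi>(1) v(2) unfolding E.dual_subspace_iff by metis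
    also have "\<dots> \<le> F v * Pr.Q x" unfolding Pr.Q_def by (rule L_le)
    finally show "t \<le> Pr.Q x"
      using F_pos[OF v(1)] by (simp add: t dual_metric_L[OF v] divide_le_eq mult.commute)
  qed
qed

lemma sphere_isoparametric:
  assumes "2 \<le> CARD('n)" "0 < r" "\<epsilon> = 1 \<or> \<epsilon> = -1"
  shows "isoparametric_hypersurface_with F \<sigma> 1 {x. F (\<epsilon> *\<^sub>R (x - x0)) = r}"
proof -
  interpret minkowski_projection F "mat 1" by unfold_locales simp
  have "tau x = x" for x by (rule tau_eqI) auto
  then have "Q = F" by (simp add: Q_def fun_eq_iff)
  moreover have "inj ((*v) (mat 1 :: real^'n^'n))" by (simp add: inj_def)
  ultimately show ?thesis
    using level_set_isoparametric[OF _ assms(2,3), of \<sigma> x0] assms(1) by simp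
qed

lemma cylinder_isoparametric:
  fixes W :: "(real^'n) set"
  assumes ip: "euclidean_inner_product ip" and W: "subspace W" "2 \<le> dim W" "dim W \<le> CARD('n) - 1"
    and x0: "x0 \<in> W" and r: "0 < r" and eps: "\<epsilon> = 1 \<or> \<epsilon> = -1"
  shows "isoparametric_hypersurface_with F \<sigma> 2
    {x. cylinder_metric F ip W (\<epsilon> *\<^sub>R (orth_projection ip W x - x0)) = r}"
proof -
  interpret E: euclidean_subspace ip W using ip W(1) by unfold_locales
  interpret Pr: minkowski_projection F E.proj_matrix
    by unfold_locales (rule E.proj_matrix_idem)
  have PE: "(*v) E.proj_matrix = E.proj" by (simp add: fun_eq_iff E.proj_matrix_apply)
  have "W \<noteq> {0}" using W(2) by auto
  have "\<epsilon> *\<^sub>R (E.proj x - x0) = E.proj (\<epsilon> *\<^sub>R (x - x0))" for x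
    by (simp add: E.proj_linear linear_scale linear_diff E.proj_id x0)
  then have "cylinder_metric F ip W (\<epsilon> *\<^sub>R (E.proj x - x0)) = Pr.Q (\<epsilon> *\<^sub>R (x - x0))" for x
    using cylinder_metric_eq[OF ip W(1) \<open>W \<noteq> {0}\<close>] by simp
  \<comment> \<open>Selects the case of two curvatures; it holds because \<open>W\<close> has
    dimension less than that of the whole space.\<close>
  moreover have "\<not> inj E.proj"
  proof
    assume "inj E.proj"
    then have "dim (range E.proj) = dim (UNIV :: (real^'n) set)"
      by (intro dim_image_eq E.proj_linear) simp
    then show False using W by (simp add: E.range_proj)
  qed
  ultimately show ?thesis
    using Pr.level_set_isoparametric[OF _ r eps, of \<sigma> x0] W(2) by (simp add: PE E.range_proj)
qed

end

section \<open>Hyperplanes, hyperspheres and cylinders together\<close>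

theorem theorem1p2:
  fixes F :: "real^'n \<Rightarrow> real" and \<sigma> :: real
  assumes "2 \<le> CARD('n)"
    and "minkowski_metric F"
    and "\<sigma> = busemann_hausdorff_density F \<or> \<sigma> = holmes_thompson_density F"
  shows "(\<forall>N. hyperplane N \<longrightarrow>
            (\<exists>k\<in>{1, 2}. isoparametric_hypersurface_with F \<sigma> k N)) \<and>
         (\<forall>x0 r. 0 < r \<longrightarrow>
            (\<exists>k\<in>{1, 2}. isoparametric_hypersurface_with F \<sigma> k (minkowski_sphere F x0 r)) \<and>
            (\<exists>k\<in>{1, 2}. isoparametric_hypersurface_with F \<sigma> k (reverse_minkowski_sphere F x0 r))) \<and>
         (\<forall>ip W x0 r. euclidean_inner_product ip \<and> subspace W \<and>
            2 \<le> dim W \<and> dim W \<le> CARD('n) - 1 \<and> x0 \<in> W \<and> 0 < r \<longrightarrow>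
            (\<exists>k\<in>{1, 2}. isoparametric_hypersurface_with F \<sigma> k
               (dual_minkowski_cylinder F ip W x0 r)) \<and>
            (\<exists>k\<in>{1, 2}. isoparametric_hypersurface_with F \<sigma> k
               (reverse_dual_minkowski_cylinder F ip W x0 r)))"
proof -
  interpret minkowski_space F using assms(2) by unfold_locales
  have "isoparametric_hypersurface_with F \<sigma> 1 (minkowski_sphere F x0 r)"
    "isoparametric_hypersurface_with F \<sigma> 1 (reverse_minkowski_sphere F x0 r)" if "0 < r" for x0 r
    using sphere_isoparametric[OF assms(1) that, of 1 \<sigma> x0] sphere_isoparametric[OF assms(1) that, of "-1" \<sigma> x0]
    by (simp_all add: minkowski_sphere_def reverse_minkowski_sphere_def)
  moreover have "isoparametric_hypersurface_with F \<sigma> 2 (dual_minkowski_cylinder F ip W x0 r)"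
    "isoparametric_hypersurface_with F \<sigma> 2 (reverse_dual_minkowski_cylinder F ip W x0 r)"
    if "euclidean_inner_product ip" "subspace W" "2 \<le> dim W" "dim W \<le> CARD('n) - 1" "x0 \<in> W" "0 < r"
    for ip W x0 r
    using cylinder_isoparametric[OF that, of 1 \<sigma>] cylinder_isoparametric[OF that, of "-1" \<sigma>]
    by (simp_all add: dual_minkowski_cylinder_def reverse_dual_minkowski_cylinder_def)
  ultimately show ?thesis
    using hyperplane_isoparametric[OF assms(1)] by blast
qed

end
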